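(* Let $(X_i)_{i\in\mathbb{Z}}$ be a semi-linear process as defined in the context, built from functions $(\alpha_i)_{i\ge0}$, with $A_i=\alpha_i\circ\pi_0$. Assume that $\sum_{k\ge0}\|\mathbb{E}(X_k\mid\mathcal{F}_0)\|_2^2<\infty$ (equivalently, $\sum_{j\ge0}j\,\|\alpha_j\|_{2,\mathcal{X}}^2<\infty$). Then the following statements are equivalent: 1. The $\mathbb{L}^2$-MA property holds. 2. The $\mathbb{L}^2_0$-MA property holds. 3. The series $\sum_{i\ge0}A_i$ converges in $\mathbb{L}^2$. Moreover, if the $\mathbb{L}^2$-MA property holds, the random variable $D$ in that property is $D=\sum_{i\ge0}A_i$.
   Context: Semi-linear process: let $(\mathcal{X},\mathcal{B},\mu)$ be a probability space and let $(\alpha_i)_{i\ge0}$ be a sequence of real functions in $\mathbb{L}^2(\mathcal{X},\mu)$ with $\mu(\alpha_i)=\int\alpha_i\,d\mu=0$ for all $i$ and $\sum_{j\ge0}\|\alpha_j\|_{2,\mathcal{X}}^2<\infty$, where $\|\cdot\|_{2,\mathcal{X}}$ is the norm of $\mathbb{L}^2(\mathcal{X},\mu)$. Let $\Omega=\mathcal{X}^{\mathbb{Z}}$ with the product $\sigma$-algebra, $\mathbb{P}=\mu^{\otimes\mathbb{Z}}$, $\pi_j(\omega)=\omega_j$, and let $T$ be the shift $(T(\omega))_i=\omega_{i+1}$. Put $A_i=\alpha_i\circ\pi_0$ and $$X_0=\sum_{j=0}^\infty A_j\circ T^{-j}=\sum_{j=0}^\infty\alpha_j\circ\pi_{-j},\qquad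 X_i=X_0\circ T^i=\sum_{j=0}^\infty A_j\circ T^{i-j}\quad(i\in\mathbb{Z}),$$ the series converging in $\mathbb{L}^2(\mathbb{P})$. Let $\mathcal{F}_i=\sigma(\pi_j,\,j\le i)$, $S_n=X_1+\cdots+X_n$, and let $\|\cdot\|_2$ be the norm of $\mathbb{L}^2(\mathbb{P})$. The $\mathbb{L}^2$-MA property means: there exists a (necessarily unique) $\mathcal{F}_0$-measurable random variable $D\in\mathbb{L}^2$ such that $\mathbb{E}(D\circ T\mid\mathcal{F}_0)=0$ a.s. and $\lim_{n\to\infty}\frac1n\big\|S_n-\sum_{k=1}^nD\circ T^k\big\|_2^2=0$. The $\mathbb{L}^2_0$-MA property means: there exists a (necessarily unique) $\mathcal{F}_0$-measurable random variable $D\in\mathbb{L}^2$ such that $\mathbb{E}(D\circ T\mid\mathcal{F}_0)=0$ a.s. and $\lim_{n\to\infty}\frac1n\,\mathbb{E}\big(\big(S_n-\sum_{k=1}^nD\circ T^k\big)^2\,\big|\,\mathcal{F}_0\big)=0$ almost surely and in $\mathbb{L}^1$. *)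

theory Defs
  imports "HOL-Probability.Probability"
begin

definition square_integrable :: "'b measure \<Rightarrow> ('b \<Rightarrow> real) \<Rightarrow> bool" where
  "square_integrable N f \<longleftrightarrow> f \<in> borel_measurable N \<and> integrable N (\<lambda>x. (f x)\<^sup>2)"

definition norm2 :: "'b measure \<Rightarrow> ('b \<Rightarrow> real) \<Rightarrow> real" where
  "norm2 N f = sqrt (\<integral>x. (f x)\<^sup>2 \<partial>N)"

text \<open>The sum is a concrete function, i.e. any representative of the sum in $L^2$.\<close>

definition L2_sums :: "'b measure \<Rightarrow> (nat \<Rightarrow> 'b \<Rightarrow> real) \<Rightarrow> ('b \<Rightarrow> real) \<Rightarrow> bool" where
  "L2_sums N f s \<longleftrightarrow>
     (\<forall>i. square_integrable N (f i)) \<and> square_integrable N s \<and>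
     (\<lambda>n. norm2 N (\<lambda>x. (\<Sum>i<n. f i x) - s x)) \<longlonglongrightarrow> 0"

definition L2_summable :: "'b measure \<Rightarrow> (nat \<Rightarrow> 'b \<Rightarrow> real) \<Rightarrow> bool" where
  "L2_summable N f \<longleftrightarrow> (\<exists>s. L2_sums N f s)"

abbreviation path_space :: "'a measure \<Rightarrow> (int \<Rightarrow> 'a) measure" where
  "path_space M \<equiv> (\<Pi>\<^sub>M i\<in>(UNIV :: int set). M)"

text \<open>\<open>shift k\<close> is the \<open>k\<close>-th iterate $T^k$, $k \in \mathbb{Z}$, of the left shift
  \<open>T = shift 1\<close>; see the three lemmas below.\<close>

definition shift :: "int \<Rightarrow> (int \<Rightarrow> 'a) \<Rightarrow> (int \<Rightarrow> 'a)" where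
  "shift k \<omega> = (\<lambda>i. \<omega> (i + k))"

lemma shift_0: "shift 0 = id"
  by (simp add: shift_def fun_eq_iff)

lemma shift_add: "shift (k + l) = shift k \<circ> shift l"
  by (simp add: shift_def fun_eq_iff algebra_simps)

lemma funpow_shift_1: "(shift 1 ^^ n) = shift (int n)"
proof (induction n)
  case (Suc n)
  then show ?case
    by (simp add: shift_add)
qed (simp add: shift_0)

text \<open>\<open>past M i\<close> is the sigma-algebra $\mathcal{F}_i = \sigma(\pi_j, j \le i)$; only its sets matter,
  the measure of the object \<open>past M i\<close> is irrelevant for \<^const>\<open>real_cond_exp\<close>.\<close>

definition past :: "'a measure \<Rightarrow> int \<Rightarrow> (int \<Rightarrow> 'a) measure" where
  "past M i = sigma (space (path_space M))
     {(\<lambda>\<omega>. \<omega> j) -` B \<inter> space (path_space M) | j B. j \<le> i \<and> B \<in> sets M}"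

lemma subalgebra_past: "subalgebra (path_space M) (past M i)"
proof -
  let ?G = "{(\<lambda>\<omega>. \<omega> j) -` B \<inter> space (path_space M) | j B. j \<le> i \<and> B \<in> sets M}"
  have G: "?G \<subseteq> sets (path_space M)"
  proof
    fix A assume "A \<in> ?G"
    then obtain j B where A: "A = (\<lambda>\<omega>. \<omega> j) -` B \<inter> space (path_space M)" and B: "B \<in> sets M"
      by blast
    show "A \<in> sets (path_space M)"
      unfolding A using measurable_component_singleton[of j UNIV "\<lambda>_. M"] B
      by (intro measurable_sets) auto
  qed
  have P: "?G \<subseteq> Pow (space (path_space M))"
    by blast
  have "sets (past M i) = sigma_sets (space (path_space M)) ?G"
    unfolding past_def by (rule sets_measure_of[OF P])
  moreover have "space (past M i) = space (path_space M)"
    unfolding past_def by (rule space_measure_of[OF P])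
  ultimately show ?thesis
    unfolding subalgebra_def using sets.sigma_sets_subset[OF G] by simp
qed

definition coord_fun :: "(nat \<Rightarrow> 'a \<Rightarrow> real) \<Rightarrow> nat \<Rightarrow> (int \<Rightarrow> 'a) \<Rightarrow> real" where
  "coord_fun \<alpha> i = \<alpha> i \<circ> (\<lambda>\<omega>. \<omega> 0)"

text \<open>\<open>X 0\<close> is a representative of the sum in $L^2$ of the series defining $X_0$. The summability and
  centring conditions on \<open>\<alpha>\<close> guarantee that such a representative exists.\<close>

definition semi_linear_process ::
    "'a measure \<Rightarrow> (nat \<Rightarrow> 'a \<Rightarrow> real) \<Rightarrow> (int \<Rightarrow> (int \<Rightarrow> 'a) \<Rightarrow> real) \<Rightarrow> bool" where
  "semi_linear_process M \<alpha> X \<longleftrightarrow>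
     prob_space M \<and>
     (\<forall>i. square_integrable M (\<alpha> i) \<and> (\<integral>x. \<alpha> i x \<partial>M) = 0) \<and>
     summable (\<lambda>i. (norm2 M (\<alpha> i))\<^sup>2) \<and>
     L2_sums (path_space M) (\<lambda>j. coord_fun \<alpha> j \<circ> shift (- int j)) (X 0) \<and>
     (\<forall>i. X i = X 0 \<circ> shift i)"

definition partial_sum :: "(int \<Rightarrow> (int \<Rightarrow> 'a) \<Rightarrow> real) \<Rightarrow> nat \<Rightarrow> (int \<Rightarrow> 'a) \<Rightarrow> real" where
  "partial_sum X n \<omega> = (\<Sum>k=1..n. X (int k) \<omega>)"

definition MA_error ::
    "(int \<Rightarrow> (int \<Rightarrow> 'a) \<Rightarrow> real) \<Rightarrow> ((int \<Rightarrow> 'a) \<Rightarrow> real) \<Rightarrow> nat \<Rightarrow> (int \<Rightarrow> 'a) \<Rightarrow> real" where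
  "MA_error X D n \<omega> = partial_sum X n \<omega> - (\<Sum>k=1..n. D (shift (int k) \<omega>))"

definition MA_increment :: "'a measure \<Rightarrow> ((int \<Rightarrow> 'a) \<Rightarrow> real) \<Rightarrow> bool" where
  "MA_increment M D \<longleftrightarrow>
     D \<in> borel_measurable (past M 0) \<and> square_integrable (path_space M) D \<and>
     (AE \<omega> in path_space M. real_cond_exp (path_space M) (past M 0) (D \<circ> shift 1) \<omega> = 0)"

definition L2_MA_with ::
    "'a measure \<Rightarrow> (int \<Rightarrow> (int \<Rightarrow> 'a) \<Rightarrow> real) \<Rightarrow> ((int \<Rightarrow> 'a) \<Rightarrow> real) \<Rightarrow> bool" where
  "L2_MA_with M X D \<longleftrightarrow>
     MA_increment M D \<and>
     (\<lambda>n. 1 / real n * (norm2 (path_space M) (MA_error X D n))\<^sup>2) \<longlonglongrightarrow> 0"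

definition L2_MA :: "'a measure \<Rightarrow> (int \<Rightarrow> (int \<Rightarrow> 'a) \<Rightarrow> real) \<Rightarrow> bool" where
  "L2_MA M X \<longleftrightarrow> (\<exists>D. L2_MA_with M X D)"

definition cond_MA_error ::
    "'a measure \<Rightarrow> (int \<Rightarrow> (int \<Rightarrow> 'a) \<Rightarrow> real) \<Rightarrow> ((int \<Rightarrow> 'a) \<Rightarrow> real) \<Rightarrow> nat \<Rightarrow> (int \<Rightarrow> 'a) \<Rightarrow> real" where
  "cond_MA_error M X D n \<omega> =
     1 / real n * real_cond_exp (path_space M) (past M 0) (\<lambda>\<omega>'. (MA_error X D n \<omega>')\<^sup>2) \<omega>"

definition L2_0_MA :: "'a measure \<Rightarrow> (int \<Rightarrow> (int \<Rightarrow> 'a) \<Rightarrow> real) \<Rightarrow> bool" where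
  "L2_0_MA M X \<longleftrightarrow>
     (\<exists>D. MA_increment M D \<and>
        (AE \<omega> in path_space M. (\<lambda>n. cond_MA_error M X D n \<omega>) \<longlonglongrightarrow> 0) \<and>
        (\<lambda>n. \<integral>\<omega>. \<bar>cond_MA_error M X D n \<omega>\<bar> \<partial>path_space M) \<longlonglongrightarrow> 0)"

end

theory Submission
  imports Defs
begin

text \<open>Write $B_m = \sum_{j<m} \alpha_j$ and $a_j = \int \alpha_j^2\,d\mu$. Splitting $X_k$ at
  time $0$ gives $X_k = E(X_k \mid F_0) + \sum_{j<k} \alpha_j \circ \pi_{k-j}$, and collecting, for
  each time $i \in \{1,\dots,n\}$, the terms that depend on the coordinate $\pi_i$ shows that for
  every candidate \<open>D\<close>
  \[ S_n - \sum_{i=1}^n D \circ T^i = R_n + Q_n, \qquad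
     R_n = \sum_{k=1}^n E(X_k \mid F_0), \qquad
     Q_n = \sum_{i=1}^n (B_{n+1-i} \circ \pi_0 - D) \circ T^i . \]

  The past part $R_n$ is negligible at the scale $\sqrt n$: $\sum_k E(X_k \mid F_0)^2$ is an
  integrable function, and a square summable sequence satisfies $(y_1 + \dots + y_n)^2 = o(n)$, so
  $R_n^2/n \to 0$ almost surely and, dominated by that function, in $L^1$ (lemmas
  \<open>past_error_AE\<close>, \<open>past_error_L1\<close>). For a martingale increment
  \<open>D\<close> the summands of $Q_n$ are orthogonal because $B_m \circ \pi_0 - D$ is again a
  martingale increment, so $E(Q_n^2) = \sum_{m=1}^n \|B_m \circ \pi_0 - D\|_2^2$ (lemma
  \<open>integral_fresh_error_square\<close>). Hence, under the hypothesis, the $L^2$-MA property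
  with \<open>D\<close> says exactly that $B_m \circ \pi_0 \to D$ in $L^2$ in the sense of Cesaro
  means.

  If $\sum_i A_i$ converges, its sum is a function of $\pi_0$; then $Q_n$ depends only on
  coordinates after time $0$, so it is independent of $F_0$ and $E((R_n + Q_n)^2 \mid F_0) = R_n^2 +
  E(Q_n^2)$, which yields the $L^2_0$-MA property. Integrating the conditional errors gives the
  $L^2$-MA property. Finally, Cesaro convergence of $B_m$ can be upgraded to convergence because the
  hypothesis is a Tauberian condition: for $n \le m \le 2n$, $\|B_m - B_n\|_2^2 = O(n \sum_{j \ge n}
  a_j)$, and this tends to $0$ when $\sum_j j\,a_j < \infty$ (lemma
  \<open>L2_sums_if_L2_MA_with\<close>).

  The equivalence of the two forms of the hypothesis is $\|E(X_k \mid F_0)\|_2^2 = \sum_{j \ge k}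
  a_j$ together with summation by parts.\<close>

section \<open>Square integrable functions\<close>

lemma square_integrable_mult_integrable:
  assumes "square_integrable N f" "square_integrable N g"
  shows "integrable N (\<lambda>x. f x * g x)"
proof (rule Bochner_Integration.integrable_bound)
  show "integrable N (\<lambda>x. (f x)\<^sup>2 + (g x)\<^sup>2)"
    using assms by (auto simp: square_integrable_def)
  show "(\<lambda>x. f x * g x) \<in> borel_measurable N"
    using assms by (auto simp: square_integrable_def)
  have "\<bar>f x * g x\<bar> \<le> (f x)\<^sup>2 + (g x)\<^sup>2" for x
    using sum_squares_bound[of "\<bar>f x\<bar>" "\<bar>g x\<bar>"] abs_ge_zero[of "f x * g x"]
    unfolding abs_mult power2_abs by linarith
  then show "AE x in N. norm (f x * g x) \<le> norm ((f x)\<^sup>2 + (g x)\<^sup>2)"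
    by (auto intro!: AE_I2)
qed

lemma square_integrable_cmult:
  "square_integrable N f \<Longrightarrow> square_integrable N (\<lambda>x. c * f x)"
  by (auto simp: square_integrable_def power_mult_distrib)

lemma square_integrable_add:
  assumes "square_integrable N f" "square_integrable N g"
  shows "square_integrable N (\<lambda>x. f x + g x)"
  using assms square_integrable_mult_integrable[OF assms]
  by (auto simp: square_integrable_def power2_sum mult.assoc)

lemma square_integrable_diff:
  assumes "square_integrable N f" "square_integrable N g"
  shows "square_integrable N (\<lambda>x. f x - g x)"
  using square_integrable_add[OF assms(1) square_integrable_cmult[OF assms(2), of "-1"]] by simp

lemma square_integrable_sum:
  assumes "\<And>i. i \<in> I \<Longrightarrow> square_integrable N (f i)"
  shows "square_integrable N (\<lambda>x. \<Sum>i\<in>I. f i x)"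
  using assms
proof (induction I rule: infinite_finite_induct)
  case (insert i I)
  then show ?case using square_integrable_add[of N "f i" "\<lambda>x. \<Sum>i\<in>I. f i x"] by simp
qed (auto simp: square_integrable_def)

lemma square_integrable_cong_AE:
  assumes "square_integrable N f" "g \<in> borel_measurable N" "AE x in N. f x = g x"
  shows "square_integrable N g"
  using assms unfolding square_integrable_def
  by (auto intro: integrable_cong_AE_imp[of N "\<lambda>x. (f x)\<^sup>2"])

lemma (in finite_measure) square_integrable_integrable:
  assumes "square_integrable M f"
  shows "integrable M f"
  using square_integrable_mult_integrable[OF assms, of "\<lambda>_. 1"]
  by (simp add: square_integrable_def)

lemma norm2_sq: "(norm2 N f)\<^sup>2 = (\<integral>x. (f x)\<^sup>2 \<partial>N)"
  by (simp add: norm2_def)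

lemma norm2_tendsto_0_iff:
  "(\<lambda>n. norm2 N (f n)) \<longlonglongrightarrow> 0 \<longleftrightarrow> (\<lambda>n. \<integral>x. (f n x)\<^sup>2 \<partial>N) \<longlonglongrightarrow> 0"
proof
  assume "(\<lambda>n. norm2 N (f n)) \<longlonglongrightarrow> 0"
  then show "(\<lambda>n. \<integral>x. (f n x)\<^sup>2 \<partial>N) \<longlonglongrightarrow> 0"
    using tendsto_power[of "\<lambda>n. norm2 N (f n)" 0 sequentially 2] by (simp add: norm2_sq)
next
  assume "(\<lambda>n. \<integral>x. (f n x)\<^sup>2 \<partial>N) \<longlonglongrightarrow> 0"
  then show "(\<lambda>n. norm2 N (f n)) \<longlonglongrightarrow> 0"
    using tendsto_real_sqrt[of "\<lambda>n. \<integral>x. (f n x)\<^sup>2 \<partial>N" 0] by (simp add: norm2_def)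
qed

lemma L2_sums_iff:
  "L2_sums N f s \<longleftrightarrow> (\<forall>i. square_integrable N (f i)) \<and> square_integrable N s \<and>
     (\<lambda>n. \<integral>x. ((\<Sum>i<n. f i x) - s x)\<^sup>2 \<partial>N) \<longlonglongrightarrow> 0"
  unfolding L2_sums_def by (subst norm2_tendsto_0_iff) simp

lemma integral_Cauchy_Schwarz:
  assumes "square_integrable N f" "square_integrable N g"
  shows "(\<integral>x. f x * g x \<partial>N)\<^sup>2 \<le> (\<integral>x. (f x)\<^sup>2 \<partial>N) * (\<integral>x. (g x)\<^sup>2 \<partial>N)"
proof -
  define A B C where "A = (\<integral>x. (f x)\<^sup>2 \<partial>N)" and "B = (\<integral>x. f x * g x \<partial>N)"
    and "C = (\<integral>x. (g x)\<^sup>2 \<partial>N)"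
  have q: "0 \<le> A - 2 * t * B + t\<^sup>2 * C" for t
  proof -
    have "0 \<le> (\<integral>x. (f x - t * g x)\<^sup>2 \<partial>N)" by simp
    also have "\<dots> = (\<integral>x. (f x)\<^sup>2 - 2 * t * (f x * g x) + t\<^sup>2 * (g x)\<^sup>2 \<partial>N)"
      by (intro Bochner_Integration.integral_cong) (auto simp: power2_diff power_mult_distrib)
    also have "\<dots> = A - 2 * t * B + t\<^sup>2 * C"
      using assms square_integrable_mult_integrable[OF assms]
      by (simp add: A_def B_def C_def square_integrable_def)
    finally show ?thesis .
  qed
  have C: "0 \<le> C" by (simp add: C_def)
  \<comment> \<open>For $C > 0$ the quadratic is minimal at $t = B/C$; for $C = 0$ it is affine in \<open>t\<close>, so $B \neq 0$ would
    make it negative somewhere, e.g. at $t = (A + 1)/(2B)$.\<close>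
  have "B\<^sup>2 \<le> A * C"
  proof (cases "C = 0")
    case True
    have "B = 0"
    proof (rule ccontr)
      assume "B \<noteq> 0"
      then show False using q[of "(A + 1) / (2 * B)"] True by simp
    qed
    then show ?thesis using True by simp
  next
    case False
    have "0 \<le> (A - 2 * (B / C) * B + (B / C)\<^sup>2 * C) * C"
      using q[of "B / C"] C by (intro mult_nonneg_nonneg) auto
    also have "\<dots> = A * C - B\<^sup>2"
      using False by (simp add: field_simps power2_eq_square)
    finally show ?thesis by simp
  qed
  then show ?thesis by (simp add: A_def B_def C_def)
qed

text \<open>Norm convergence implies weak convergence; this makes squared norms and expectations
  continuous in $L^2$.\<close>

lemma integral_mult_tendsto_0:
  assumes f: "square_integrable N f" and g: "\<And>n. square_integrable N (g n)"
    and lim: "(\<lambda>n. \<integral>x. (g n x)\<^sup>2 \<partial>N) \<longlonglongrightarrow> 0"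
  shows "(\<lambda>n. \<integral>x. f x * g n x \<partial>N) \<longlonglongrightarrow> 0"
proof -
  have "(\<lambda>n. (\<integral>x. f x * g n x \<partial>N)\<^sup>2) \<longlonglongrightarrow> 0"
  proof (rule tendsto_sandwich[OF _ _ tendsto_const])
    show "(\<lambda>n. (\<integral>x. (f x)\<^sup>2 \<partial>N) * (\<integral>x. (g n x)\<^sup>2 \<partial>N)) \<longlonglongrightarrow> 0"
      using tendsto_mult_right_zero[OF lim] by simp
  qed (auto intro!: always_eventually integral_Cauchy_Schwarz f g)
  then show ?thesis
    using tendsto_real_sqrt tendsto_rabs_zero_iff by fastforce
qed

lemma integral_square_tendsto:
  assumes f: "\<And>n. square_integrable N (f n)" and g: "square_integrable N g"
    and lim: "(\<lambda>n. \<integral>x. (f n x - g x)\<^sup>2 \<partial>N) \<longlonglongrightarrow> 0"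
  shows "(\<lambda>n. \<integral>x. (f n x)\<^sup>2 \<partial>N) \<longlonglongrightarrow> (\<integral>x. (g x)\<^sup>2 \<partial>N)"
proof -
  have d: "square_integrable N (\<lambda>x. f n x - g x)" for n
    by (intro square_integrable_diff f g)
  have "(\<integral>x. (f n x)\<^sup>2 \<partial>N)
      = (\<integral>x. (f n x - g x)\<^sup>2 \<partial>N) + 2 * (\<integral>x. g x * (f n x - g x) \<partial>N) + (\<integral>x. (g x)\<^sup>2 \<partial>N)" for n
  proof -
    have "(\<integral>x. (f n x)\<^sup>2 \<partial>N)
        = (\<integral>x. (f n x - g x)\<^sup>2 + 2 * (g x * (f n x - g x)) + (g x)\<^sup>2 \<partial>N)"
      by (intro Bochner_Integration.integral_cong) (auto simp: power2_eq_square algebra_simps)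
    then show ?thesis
      using d[of n] g square_integrable_mult_integrable[OF g d[of n]]
      by (simp add: square_integrable_def)
  qed
  moreover have "(\<lambda>n. (\<integral>x. (f n x - g x)\<^sup>2 \<partial>N) + 2 * (\<integral>x. g x * (f n x - g x) \<partial>N)
      + (\<integral>x. (g x)\<^sup>2 \<partial>N)) \<longlonglongrightarrow> 0 + 2 * 0 + (\<integral>x. (g x)\<^sup>2 \<partial>N)"
    by (intro tendsto_intros lim integral_mult_tendsto_0 g d)
  ultimately show ?thesis by simp
qed

lemma integral_square_sum_orthogonal:
  assumes "finite I" and "\<And>i. i \<in> I \<Longrightarrow> square_integrable N (f i)"
    and "\<And>i j. i \<in> I \<Longrightarrow> j \<in> I \<Longrightarrow> i \<noteq> j \<Longrightarrow> (\<integral>x. f i x * f j x \<partial>N) = 0"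
  shows "(\<integral>x. (\<Sum>i\<in>I. f i x)\<^sup>2 \<partial>N) = (\<Sum>i\<in>I. \<integral>x. (f i x)\<^sup>2 \<partial>N)"
proof -
  have "(\<integral>x. (\<Sum>i\<in>I. f i x)\<^sup>2 \<partial>N) = (\<integral>x. (\<Sum>i\<in>I. \<Sum>j\<in>I. f i x * f j x) \<partial>N)"
    by (simp add: power2_eq_square sum_product)
  also have "\<dots> = (\<Sum>i\<in>I. \<Sum>j\<in>I. \<integral>x. f i x * f j x \<partial>N)"
    using assms(2) by (subst Bochner_Integration.integral_sum)
      (auto intro!: Bochner_Integration.integrable_sum square_integrable_mult_integrable
        Bochner_Integration.integral_sum sum.cong)
  also have "\<dots> = (\<Sum>i\<in>I. \<Sum>j\<in>I. if i = j then \<integral>x. (f i x)\<^sup>2 \<partial>N else 0)"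
    using assms(3) by (intro sum.cong refl) (auto simp: power2_eq_square)
  finally show ?thesis using assms(1) by simp
qed

lemma integral_square_add_le:
  assumes "square_integrable N f" "square_integrable N g"
  shows "(\<integral>x. (f x + g x)\<^sup>2 \<partial>N) \<le> 2 * (\<integral>x. (f x)\<^sup>2 \<partial>N) + 2 * (\<integral>x. (g x)\<^sup>2 \<partial>N)"
proof -
  have "(f x + g x)\<^sup>2 \<le> 2 * (f x)\<^sup>2 + 2 * (g x)\<^sup>2" for x
    using sum_squares_bound[of "f x" "g x"] by (simp add: power2_sum)
  then have "(\<integral>x. (f x + g x)\<^sup>2 \<partial>N) \<le> (\<integral>x. 2 * (f x)\<^sup>2 + 2 * (g x)\<^sup>2 \<partial>N)"
    using assms square_integrable_add[OF assms]
    by (intro integral_mono) (auto simp: square_integrable_def)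
  then show ?thesis using assms by (simp add: square_integrable_def)
qed

lemma (in finite_measure_subalgebra) cond_exp_square_le:
  assumes "square_integrable M f"
  shows "square_integrable M (real_cond_exp M F f)"
    and "(\<integral>x. (real_cond_exp M F f x)\<^sup>2 \<partial>M) \<le> (\<integral>x. (f x)\<^sup>2 \<partial>M)"
proof -
  have i: "integrable M f" "integrable M (\<lambda>x. (f x)\<^sup>2)"
    using assms square_integrable_integrable[OF assms] by (auto simp: square_integrable_def)
  have c: "convex_on UNIV (\<lambda>x::real. x\<^sup>2)"
    using convex_power_even[of 2] by simp
  have jensen: "AE x in M. (real_cond_exp M F f x)\<^sup>2 \<le> real_cond_exp M F (\<lambda>x. (f x)\<^sup>2) x"
    by (rule real_cond_exp_jensens_inequality(2)[of f UNIV 0 0]) (auto simp: i c)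
  have int: "integrable M (\<lambda>x. (real_cond_exp M F f x)\<^sup>2)"
    by (rule integrable_convex_cond_exp[of f UNIV 0 0]) (auto simp: i c)
  then show "square_integrable M (real_cond_exp M F f)"
    by (simp add: square_integrable_def)
  have "(\<integral>x. (real_cond_exp M F f x)\<^sup>2 \<partial>M) \<le> (\<integral>x. real_cond_exp M F (\<lambda>x. (f x)\<^sup>2) x \<partial>M)"
    using jensen int i by (intro integral_mono_AE) auto
  then show "(\<integral>x. (real_cond_exp M F f x)\<^sup>2 \<partial>M) \<le> (\<integral>x. (f x)\<^sup>2 \<partial>M)"
    using real_cond_exp_int(2)[OF i(2)] by simp
qed

text \<open>An $L^2$-limit of \<open>F\<close>-measurable functions is only almost everywhere equal
  to an \<open>F\<close>-measurable function, so the conclusion is phrased through the conditional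
  expectation. It follows from $E(g \mid F) - g = -E(f_n - g \mid F) + (f_n - g)$ and the
  contraction property.\<close>

lemma (in finite_measure_subalgebra) cond_exp_L2_limit:
  assumes f: "\<And>n. f n \<in> borel_measurable F" "\<And>n. square_integrable M (f n)"
    and g: "square_integrable M g"
    and lim: "(\<lambda>n. \<integral>x. (f n x - g x)\<^sup>2 \<partial>M) \<longlonglongrightarrow> 0"
  shows "AE x in M. real_cond_exp M F g x = g x"
proof -
  let ?E = "real_cond_exp M F"
  have E: "square_integrable M (?E g)" by (rule cond_exp_square_le[OF g])
  have d: "square_integrable M (\<lambda>x. f n x - g x)" for n
    by (intro square_integrable_diff f g)
  have le: "(\<integral>x. (?E g x - g x)\<^sup>2 \<partial>M) \<le> 4 * (\<integral>x. (f n x - g x)\<^sup>2 \<partial>M)" for n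
  proof -
    let ?h = "\<lambda>x. f n x - g x"
    have "AE x in M. ?E ?h x = ?E (f n) x - ?E g x"
      by (intro real_cond_exp_diff square_integrable_integrable f g)
    moreover have "AE x in M. ?E (f n) x = f n x"
      by (intro real_cond_exp_F_meas square_integrable_integrable f)
    ultimately have "AE x in M. ?E g x - g x = - ?E ?h x + ?h x"
      by eventually_elim simp
    then have "AE x in M. (?E g x - g x)\<^sup>2 = (- ?E ?h x + ?h x)\<^sup>2"
      by eventually_elim (simp only:)
    then have "(\<integral>x. (?E g x - g x)\<^sup>2 \<partial>M) = (\<integral>x. (- ?E ?h x + ?h x)\<^sup>2 \<partial>M)"
      using g d[of n] by (intro integral_cong_AE) (auto simp: square_integrable_def)
    also have "\<dots> \<le> 2 * (\<integral>x. (- ?E ?h x)\<^sup>2 \<partial>M) + 2 * (\<integral>x. (?h x)\<^sup>2 \<partial>M)"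
      using square_integrable_cmult[OF cond_exp_square_le(1)[OF d[of n]], of "-1"]
      by (intro integral_square_add_le d) simp
    also have "\<dots> \<le> 4 * (\<integral>x. (?h x)\<^sup>2 \<partial>M)"
      using cond_exp_square_le(2)[OF d[of n]] by simp
    finally show ?thesis .
  qed
  have "(\<lambda>n. 4 * (\<integral>x. (f n x - g x)\<^sup>2 \<partial>M)) \<longlonglongrightarrow> 0"
    by (intro tendsto_mult_right_zero lim)
  then have "(\<integral>x. (?E g x - g x)\<^sup>2 \<partial>M) \<le> 0"
    by (rule LIMSEQ_le_const) (use le in blast)
  then have "(\<integral>x. (?E g x - g x)\<^sup>2 \<partial>M) = 0"
    by (intro antisym) auto
  then have "AE x in M. (?E g x - g x)\<^sup>2 = 0"
    using square_integrable_diff[OF E g]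
    by (subst integral_nonneg_eq_0_iff_AE[symmetric]) (auto simp: square_integrable_def)
  then show ?thesis by simp
qed

section \<open>Independent coordinates and the shift\<close>

text \<open>A common generalisation of the past and of the strict future $\sigma(\pi_j, j > 0)$:
  blocks of coordinates with disjoint index sets are independent.\<close>

definition coord_sigma :: "'a measure \<Rightarrow> int set \<Rightarrow> (int \<Rightarrow> 'a) measure" where
  "coord_sigma M J = sigma (space (path_space M))
     (\<Union>j\<in>J. {(\<lambda>\<omega>. \<omega> j) -` B \<inter> space (path_space M) | B. B \<in> sets M})"

lemma past_eq_coord_sigma: "past M i = coord_sigma M {..i}"
  unfolding past_def coord_sigma_def by (rule arg_cong2[where f=sigma]) auto

lemma space_coord_sigma [simp]: "space (coord_sigma M J) = space (path_space M)"
  unfolding coord_sigma_def by (rule space_measure_of) auto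

lemma sets_coord_sigma:
  "sets (coord_sigma M J) = sigma_sets (space (path_space M))
     (\<Union>j\<in>J. {(\<lambda>\<omega>. \<omega> j) -` B \<inter> space (path_space M) | B. B \<in> sets M})"
  unfolding coord_sigma_def by (rule sets_measure_of) auto

lemma coordinate_measurable_coord_sigma:
  assumes "j \<in> J"
  shows "(\<lambda>\<omega>. \<omega> j) \<in> measurable (coord_sigma M J) M"
proof (rule measurableI)
  show "\<omega> j \<in> space M" if "\<omega> \<in> space (coord_sigma M J)" for \<omega>
    using that by (auto simp: space_PiM)
  show "(\<lambda>\<omega>. \<omega> j) -` B \<inter> space (coord_sigma M J) \<in> sets (coord_sigma M J)" if "B \<in> sets M" for B
    using assms that by (auto simp: sets_coord_sigma intro!: sigma_sets.Basic)
qed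

lemma sigma_sets_vimage_subset:
  assumes "f \<in> measurable N L"
  shows "sigma_sets (space N) {f -` B \<inter> space N | B. B \<in> sets L} \<subseteq> sets N"
  using assms by (intro sets.sigma_sets_subset) (auto intro: measurable_sets)

lemma shift_measurable_past:
  assumes "i + k \<le> l"
  shows "shift k \<in> measurable (past M l) (past M i)"
  unfolding past_eq_coord_sigma[of M i] coord_sigma_def
proof (rule measurable_measure_of)
  show "shift k \<in> space (past M l) \<rightarrow> space (path_space M)"
    by (auto simp: past_eq_coord_sigma shift_def space_PiM)
  fix A assume "A \<in> (\<Union>j\<in>{..i}. {(\<lambda>\<omega>. \<omega> j) -` B \<inter> space (path_space M) | B. B \<in> sets M})"
  then obtain j B where j: "j \<le> i" "B \<in> sets M"
      "A = (\<lambda>\<omega>. \<omega> j) -` B \<inter> space (path_space M)" by auto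
  then have "shift k -` A \<inter> space (past M l) = (\<lambda>\<omega>. \<omega> (j + k)) -` B \<inter> space (past M l)"
    by (auto simp: shift_def past_eq_coord_sigma space_PiM PiE_UNIV_domain Pi_iff)
  also have "\<dots> \<in> sets (past M l)"
    using j assms unfolding past_eq_coord_sigma
    by (intro measurable_sets[OF coordinate_measurable_coord_sigma]) auto
  finally show "shift k -` A \<inter> space (past M l) \<in> sets (past M l)" .
qed blast

locale iid_path = prob_space M for M :: "'a measure"
begin

abbreviation "\<P> \<equiv> path_space M"
abbreviation "\<F> \<equiv> past M 0"

sublocale P: prob_space \<P>
  by (intro prob_space_PiM prob_space_axioms)

sublocale P: finite_measure_subalgebra \<P> \<F>
  by unfold_locales (rule subalgebra_past)

lemma coordinate_measurable [measurable]: "(\<lambda>\<omega>. \<omega> i) \<in> measurable \<P> M"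
  by (rule measurable_component_singleton) simp

lemma shift_measurable [measurable]: "shift k \<in> measurable \<P> \<P>"
  unfolding shift_def by (rule measurable_PiM_single') (auto simp: space_PiM)

lemma distr_shift: "distr \<P> \<P> (shift k) = \<P>"
proof -
  have "distr \<P> \<P> (\<lambda>\<omega>. \<lambda>n\<in>UNIV. \<omega> (n + k)) = \<P>"
    using distr_PiM_reindex[of UNIV "\<lambda>_. M" "\<lambda>i. i + k" UNIV] prob_space_axioms
    by (auto simp: inj_on_def)
  moreover have "(\<lambda>\<omega> :: int \<Rightarrow> 'a. \<lambda>n\<in>UNIV. \<omega> (n + k)) = shift k"
    by (auto simp: shift_def fun_eq_iff)
  ultimately show ?thesis by (simp only:)
qed

lemma integral_shift:
  fixes f :: "(int \<Rightarrow> 'a) \<Rightarrow> real"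
  assumes "f \<in> borel_measurable \<P>"
  shows "(\<integral>\<omega>. f (shift k \<omega>) \<partial>\<P>) = (\<integral>\<omega>. f \<omega> \<partial>\<P>)"
  using integral_distr[OF shift_measurable assms, of k] by (simp add: distr_shift)

lemma integrable_shift:
  fixes f :: "(int \<Rightarrow> 'a) \<Rightarrow> real"
  assumes "integrable \<P> f"
  shows "integrable \<P> (\<lambda>\<omega>. f (shift k \<omega>))"
  by (rule integrable_distr[OF shift_measurable]) (simp add: distr_shift assms)

lemma square_integrable_shift:
  assumes "square_integrable \<P> f"
  shows "square_integrable \<P> (\<lambda>\<omega>. f (shift k \<omega>))"
  using assms integrable_shift[of "\<lambda>\<omega>. (f \<omega>)\<^sup>2" k]
  by (auto simp: square_integrable_def intro: measurable_compose[OF shift_measurable])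

lemma distr_coordinate: "distr \<P> M (\<lambda>\<omega>. \<omega> i) = M"
  using distr_PiM_component[of UNIV "\<lambda>_. M" i] prob_space_axioms by simp

lemma integral_coordinate:
  fixes a :: "'a \<Rightarrow> real"
  assumes "a \<in> borel_measurable M"
  shows "(\<integral>\<omega>. a (\<omega> i) \<partial>\<P>) = (\<integral>x. a x \<partial>M)"
  using integral_distr[OF coordinate_measurable assms, of i] by (simp add: distr_coordinate)

lemma square_integrable_coordinate:
  assumes "square_integrable M a"
  shows "square_integrable \<P> (\<lambda>\<omega>. a (\<omega> i))"
  unfolding square_integrable_def
proof
  show "integrable \<P> (\<lambda>\<omega>. (a (\<omega> i))\<^sup>2)"
    by (rule integrable_distr[OF coordinate_measurable])
      (use assms in \<open>simp add: distr_coordinate square_integrable_def\<close>)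
qed (use assms in \<open>auto simp: square_integrable_def intro: measurable_compose[OF coordinate_measurable]\<close>)

lemma indep_coordinates: "P.indep_vars (\<lambda>_. M) (\<lambda>i \<omega>. \<omega> i) (UNIV :: int set)"
proof (subst P.indep_vars_iff_distr_eq_PiM)
  have "distr \<P> \<P> (\<lambda>x. \<lambda>i\<in>UNIV. x i) = \<P>"
    using distr_id[of \<P>] by (simp add: restrict_def id_def)
  then show "distr \<P> \<P> (\<lambda>x. \<lambda>i\<in>UNIV. x i) = (\<Pi>\<^sub>M i\<in>UNIV. distr \<P> M (\<lambda>\<omega>. \<omega> i))"
    by (simp add: distr_coordinate)
qed auto

lemma indep_coord_sigma:
  assumes "J \<inter> K = {}"
  shows "P.indep_set (sets (coord_sigma M J)) (sets (coord_sigma M K))"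
proof -
  let ?E = "\<lambda>i::int. {(\<lambda>\<omega>. \<omega> i) -` B \<inter> space \<P> | B. B \<in> sets M}"
  have "P.indep_sets ?E UNIV"
    using indep_coordinates unfolding P.indep_vars_def2 by simp
  then have "P.indep_sets ?E (\<Union>b\<in>UNIV. case_bool J K b)"
    by (rule P.indep_sets_mono_index[rotated]) simp
  then have "P.indep_sets (\<lambda>b. sigma_sets (space \<P>) (\<Union>i\<in>case_bool J K b. ?E i)) UNIV"
  proof (rule P.indep_sets_collect_sigma)
    show "Int_stable (?E i)" for i
    proof (rule Int_stableI)
      fix a b assume "a \<in> ?E i" "b \<in> ?E i"
      then obtain A B where "A \<in> sets M" "B \<in> sets M"
        "a = (\<lambda>\<omega>. \<omega> i) -` A \<inter> space \<P>" "b = (\<lambda>\<omega>. \<omega> i) -` B \<inter> space \<P>" by blast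
      then show "a \<inter> b \<in> ?E i" by (auto intro!: exI[of _ "A \<inter> B"])
    qed
    show "disjoint_family_on (case_bool J K) UNIV"
      using assms by (auto simp: disjoint_family_on_def split: bool.splits)
  qed
  then show ?thesis
    unfolding P.indep_set_def
    by (rule P.indep_sets_mono_sets) (auto simp: sets_coord_sigma split: bool.splits)
qed

text \<open>This is the independence of the past from the strict future, in the form in which it is
  used.\<close>

lemma cond_exp_future:
  assumes int: "integrable \<P> f" and meas: "f \<in> borel_measurable (coord_sigma M {0<..})"
  shows "AE \<omega> in \<P>. real_cond_exp \<P> \<F> f \<omega> = (\<integral>\<omega>. f \<omega> \<partial>\<P>)"
proof (rule P.real_cond_exp_charact)
  fix A assume A: "A \<in> sets \<F>"
  then have A': "A \<in> sets \<P>" using subalgebra_past by (auto simp: subalgebra_def)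
  have "P.indep_set (sets (coord_sigma M {..0})) (sets (coord_sigma M {0<..}))"
    by (rule indep_coord_sigma) auto
  then have "P.indep_set (sigma_sets (space \<P>) {(indicator A :: _ \<Rightarrow> real) -` B \<inter> space \<P> | B. B \<in> sets borel})
      (sigma_sets (space \<P>) {f -` B \<inter> space \<P> | B. B \<in> sets borel})"
    unfolding P.indep_set_def
  proof (rule P.indep_sets_mono_sets)
    have "indicator A \<in> borel_measurable (coord_sigma M {..0})"
      using A by (simp add: past_eq_coord_sigma)
    from sigma_sets_vimage_subset[OF this]
    have "sigma_sets (space \<P>) {(indicator A :: _ \<Rightarrow> real) -` B \<inter> space \<P> | B. B \<in> sets borel}
        \<subseteq> sets (coord_sigma M {..0})" by simp
    moreover from sigma_sets_vimage_subset[OF meas]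
    have "sigma_sets (space \<P>) {f -` B \<inter> space \<P> | B. B \<in> sets borel}
        \<subseteq> sets (coord_sigma M {0<..})" by simp
    ultimately show "(case b of True \<Rightarrow> sigma_sets (space \<P>) {(indicator A :: _ \<Rightarrow> real) -` B \<inter> space \<P> | B. B \<in> sets borel}
        | False \<Rightarrow> sigma_sets (space \<P>) {f -` B \<inter> space \<P> | B. B \<in> sets borel})
        \<subseteq> (case b of True \<Rightarrow> sets (coord_sigma M {..0}) | False \<Rightarrow> sets (coord_sigma M {0<..}))" for b
      by (cases b) auto
  qed
  then have "P.indep_var borel (indicator A :: _ \<Rightarrow> real) borel f"
    using A' int by (simp add: P.indep_var_eq borel_measurable_integrable)
  then have "(\<integral>\<omega>. indicator A \<omega> * f \<omega> \<partial>\<P>) = (\<integral>\<omega>. indicator A \<omega> \<partial>\<P>) * (\<integral>\<omega>. f \<omega> \<partial>\<P>)"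
    using A' int by (intro P.indep_var_lebesgue_integral) (auto simp: P.emeasure_eq_measure)
  then show "(\<integral>\<omega>\<in>A. f \<omega> \<partial>\<P>) = (\<integral>\<omega>\<in>A. (\<integral>\<omega>. f \<omega> \<partial>\<P>) \<partial>\<P>)"
    using A' by (simp add: set_lebesgue_integral_def mult.commute)
qed (use int in auto)

lemma MA_increment_coordinate:
  assumes "square_integrable M a" "(\<integral>x. a x \<partial>M) = 0"
  shows "MA_increment M (\<lambda>\<omega>. a (\<omega> 0))"
proof -
  have m: "a \<in> borel_measurable M" using assms by (simp add: square_integrable_def)
  have "AE \<omega> in \<P>. real_cond_exp \<P> \<F> (\<lambda>\<omega>. a (\<omega> 1)) \<omega> = (\<integral>\<omega>. a (\<omega> 1) \<partial>\<P>)"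
    using m by (intro cond_exp_future P.square_integrable_integrable square_integrable_coordinate assms)
      (auto intro!: measurable_compose[OF coordinate_measurable_coord_sigma])
  moreover have "(\<lambda>\<omega>. a (\<omega> 0)) \<circ> shift 1 = (\<lambda>\<omega>. a (\<omega> 1))"
    by (auto simp: shift_def)
  ultimately show ?thesis
    using m assms unfolding MA_increment_def
    by (auto simp: integral_coordinate past_eq_coord_sigma intro!: square_integrable_coordinate
        measurable_compose[OF coordinate_measurable_coord_sigma])
qed

lemma MA_increment_diff:
  assumes f: "MA_increment M f" and g: "MA_increment M g"
  shows "MA_increment M (\<lambda>\<omega>. f \<omega> - g \<omega>)"
proof -
  have *: "integrable \<P> (f \<circ> shift 1)" "integrable \<P> (g \<circ> shift 1)"
    using f g unfolding comp_def MA_increment_def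
    by (blast intro: integrable_shift[OF P.square_integrable_integrable])+
  have "AE \<omega> in \<P>. real_cond_exp \<P> \<F> (\<lambda>\<omega>. (f \<circ> shift 1) \<omega> - (g \<circ> shift 1) \<omega>) \<omega> =
      real_cond_exp \<P> \<F> (f \<circ> shift 1) \<omega> - real_cond_exp \<P> \<F> (g \<circ> shift 1) \<omega>"
    by (intro P.real_cond_exp_diff *)
  moreover have "(\<lambda>\<omega>. f \<omega> - g \<omega>) \<circ> shift 1 = (\<lambda>\<omega>. (f \<circ> shift 1) \<omega> - (g \<circ> shift 1) \<omega>)"
    by auto
  ultimately show ?thesis
    using f g unfolding MA_increment_def by (auto intro!: square_integrable_diff)
qed

text \<open>Shift time so that the later of the two factors becomes an increment at time $1$ and the
  earlier one $F_0$-measurable; then condition on $F_0$.\<close>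

lemma MA_increment_orthogonal:
  assumes f: "MA_increment M f" and g: "MA_increment M g" and "i \<noteq> l"
  shows "(\<integral>\<omega>. f (shift i \<omega>) * g (shift l \<omega>) \<partial>\<P>) = 0"
proof -
  have less: "(\<integral>\<omega>. f (shift i \<omega>) * g (shift l \<omega>) \<partial>\<P>) = 0"
    if f: "MA_increment M f" and g: "MA_increment M g" and il: "i < l" for f g i l
  proof -
    define u where "u = (\<lambda>\<omega>. f (shift (i - l + 1) \<omega>))"
    define v where "v = g \<circ> shift 1"
    have u: "u \<in> borel_measurable \<F>" "square_integrable \<P> u"
      using f il unfolding u_def MA_increment_def
      by (auto intro!: square_integrable_shift measurable_compose[OF shift_measurable_past])
    have v: "square_integrable \<P> v" "AE \<omega> in \<P>. real_cond_exp \<P> \<F> v \<omega> = 0"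
      using g square_integrable_shift[of g 1] unfolding v_def MA_increment_def comp_def by auto
    have uv: "integrable \<P> (\<lambda>\<omega>. u \<omega> * v \<omega>)"
      by (rule square_integrable_mult_integrable) fact+
    have "(\<integral>\<omega>. f (shift i \<omega>) * g (shift l \<omega>) \<partial>\<P>) = (\<integral>\<omega>. u (shift (l - 1) \<omega>) * v (shift (l - 1) \<omega>) \<partial>\<P>)"
      unfolding u_def v_def by (simp add: shift_def comp_def algebra_simps)
    also have "\<dots> = (\<integral>\<omega>. u \<omega> * v \<omega> \<partial>\<P>)"
      by (rule integral_shift) (use uv in auto)
    also have "\<dots> = (\<integral>\<omega>. u \<omega> * real_cond_exp \<P> \<F> v \<omega> \<partial>\<P>)"
      using v by (intro P.real_cond_exp_intg(2)[symmetric] uv u) (auto simp: square_integrable_def)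
    also have "\<dots> = (\<integral>\<omega>. 0 \<partial>\<P>)"
      using v u(2) by (intro integral_cong_AE) (auto simp: square_integrable_def)
    finally show ?thesis by simp
  qed
  show ?thesis
  proof (cases "i < l")
    case False
    then have "l < i" using assms by simp
    then show ?thesis using less[OF g f, of l i] by (simp add: mult.commute)
  qed (use less f g in auto)
qed

lemma integral_square_sum_increments:
  assumes "finite I" and "inj_on \<tau> I" and "\<And>i. i \<in> I \<Longrightarrow> MA_increment M (f i)"
  shows "(\<integral>\<omega>. (\<Sum>i\<in>I. f i (shift (\<tau> i) \<omega>))\<^sup>2 \<partial>\<P>) = (\<Sum>i\<in>I. \<integral>\<omega>. (f i \<omega>)\<^sup>2 \<partial>\<P>)"
proof -
  have si: "square_integrable \<P> (f i)" if "i \<in> I" for i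
    using assms(3)[OF that] by (simp add: MA_increment_def)
  have "(\<integral>\<omega>. (\<Sum>i\<in>I. f i (shift (\<tau> i) \<omega>))\<^sup>2 \<partial>\<P>) = (\<Sum>i\<in>I. \<integral>\<omega>. (f i (shift (\<tau> i) \<omega>))\<^sup>2 \<partial>\<P>)"
    using assms si by (intro integral_square_sum_orthogonal)
      (auto intro!: square_integrable_shift MA_increment_orthogonal simp: inj_on_def)
  also have "\<dots> = (\<Sum>i\<in>I. \<integral>\<omega>. (f i \<omega>)\<^sup>2 \<partial>\<P>)"
    using si by (intro sum.cong refl integral_shift) (auto simp: square_integrable_def)
  finally show ?thesis .
qed

end

section \<open>Tails of series and Cesaro means\<close>

definition tail :: "(nat \<Rightarrow> real) \<Rightarrow> nat \<Rightarrow> real" where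
  "tail a k = (\<Sum>j. a (j + k))"

lemma tail_Suc:
  assumes "summable a"
  shows "tail a k = a k + tail a (Suc k)"
  using suminf_split_head[of "\<lambda>j. a (j + k)"] assms by (simp add: tail_def summable_iff_shift)

lemma tail_nonneg:
  assumes "summable a" "\<And>j. 0 \<le> a j"
  shows "0 \<le> tail a k"
  unfolding tail_def using assms by (intro suminf_nonneg) (auto simp: summable_iff_shift)

lemma tail_tendsto_0:
  assumes "summable a"
  shows "tail a \<longlonglongrightarrow> 0"
proof -
  have "(\<lambda>n. suminf a - (\<Sum>j<n. a j)) \<longlonglongrightarrow> suminf a - suminf a"
    by (intro tendsto_intros summable_LIMSEQ assms)
  then show ?thesis
    using suminf_minus_initial_segment[OF assms] by (simp add: tail_def[abs_def])
qed

lemma sum_le_tail: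
  assumes "summable a" "\<And>j. 0 \<le> a j"
  shows "(\<Sum>j=n..<m. a j) \<le> tail a n"
proof (cases "n \<le> m")
  case True
  have "(\<Sum>j=n..<m. a j) = (\<Sum>j<m - n. a (j + n))"
    using True sum.shift_bounds_nat_ivl[of a 0 n "m - n"] by (simp add: atLeast0LessThan)
  also have "\<dots> \<le> tail a n"
    unfolding tail_def using assms by (intro sum_le_suminf) (auto simp: summable_iff_shift)
  finally show ?thesis .
qed (use tail_nonneg[OF assms] in auto)

text \<open>Summation by parts: this identity relates summability of the tails to a first
  moment.\<close>

lemma sum_tail:
  assumes "summable a"
  shows "(\<Sum>k<n. tail a k) = real n * tail a n + (\<Sum>j<n. (real j + 1) * a j)"
proof (induction n)
  case (Suc n)
  then show ?case using tail_Suc[OF assms, of n] by (simp add: algebra_simps)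
qed simp

lemma mult_tail_le:
  assumes "summable a" "\<And>j. 0 \<le> a j" "summable (\<lambda>j. real j * a j)"
  shows "real n * tail a n \<le> tail (\<lambda>j. real j * a j) n"
proof -
  have "real n * tail a n = (\<Sum>j. real n * a (j + n))"
    unfolding tail_def using assms by (intro suminf_mult[symmetric]) (auto simp: summable_iff_shift)
  also have "\<dots> \<le> tail (\<lambda>j. real j * a j) n"
    unfolding tail_def
  proof (intro suminf_le summable_mult)
    show "summable (\<lambda>j. real (j + n) * a (j + n))"
      using assms(3) by (subst summable_iff_shift)
  qed (use assms in \<open>auto intro: mult_right_mono simp: summable_iff_shift\<close>)
  finally show ?thesis .
qed

lemma summable_tail_iff:
  assumes a: "summable a" "\<And>j. 0 \<le> a j"
  shows "summable (tail a) \<longleftrightarrow> summable (\<lambda>j. real j * a j)"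
proof
  assume t: "summable (tail a)"
  show "summable (\<lambda>j. real j * a j)"
  proof (rule summable_comparison_test')
    show "summable (\<lambda>j. (real j + 1) * a j)"
    proof (rule bounded_imp_summable)
      fix n
      have "(\<Sum>j\<le>n. (real j + 1) * a j) \<le> (\<Sum>k\<le>n. tail a k)"
        using sum_tail[OF a(1), of "Suc n"] tail_nonneg[OF a, of "Suc n"]
        by (simp only: lessThan_Suc_atMost) simp
      also have "\<dots> \<le> suminf (tail a)"
        using t tail_nonneg[OF a] by (intro sum_le_suminf) auto
      finally show "(\<Sum>j\<le>n. (real j + 1) * a j) \<le> suminf (tail a)" .
    qed (use a in auto)
    show "norm (real n * a n) \<le> (real n + 1) * a n" for n
      using a(2)[of n] by (simp add: mult_right_mono)
  qed
next
  assume s: "summable (\<lambda>j. real j * a j)"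
  then have s': "summable (\<lambda>j. (real j + 1) * a j)"
    using summable_add[OF s a(1)] by (simp add: algebra_simps)
  show "summable (tail a)"
  proof (rule bounded_imp_summable)
    fix n
    have "tail (\<lambda>j. real j * a j) (Suc n) \<le> (\<Sum>j. real j * a j)"
      using suminf_minus_initial_segment[OF s, of "Suc n"] a(2)
      by (simp add: tail_def sum_nonneg del: sum.lessThan_Suc)
    then have "real (Suc n) * tail a (Suc n) \<le> (\<Sum>j. real j * a j)"
      using mult_tail_le[OF a s, of "Suc n"] by linarith
    moreover have "(\<Sum>j<Suc n. (real j + 1) * a j) \<le> (\<Sum>j. (real j + 1) * a j)"
      using a(2) by (intro sum_le_suminf s') auto
    ultimately show "(\<Sum>k\<le>n. tail a k) \<le> (\<Sum>j. real j * a j) + (\<Sum>j. (real j + 1) * a j)"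
      using sum_tail[OF a(1), of "Suc n"] by (simp only: lessThan_Suc_atMost)
  qed (use tail_nonneg[OF a] in auto)
qed

lemma mult_tail_tendsto_0:
  assumes "summable a" "\<And>j. 0 \<le> a j" "summable (\<lambda>j. real j * a j)"
  shows "(\<lambda>n. real n * tail a n) \<longlonglongrightarrow> 0"
  by (rule tendsto_sandwich[OF _ _ tendsto_const tail_tendsto_0[OF assms(3)]])
    (auto intro!: always_eventually mult_tail_le assms tail_nonneg mult_nonneg_nonneg)

text \<open>Both averaging arguments below split a sum at a fixed index: the initial block
  contributes $C/n$, the rest at most $e$.\<close>

lemma tendsto_0_if_le_inverse:
  fixes u :: "nat \<Rightarrow> real"
  assumes "\<And>n. 0 \<le> u n"
    and "\<And>e. 0 < e \<Longrightarrow> \<exists>C. \<forall>n>0. u n \<le> C / real n + e"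
  shows "u \<longlonglongrightarrow> 0"
proof (rule order_tendstoI)
  fix e :: real assume "0 < e"
  then obtain C where C: "\<And>n. n > 0 \<Longrightarrow> u n \<le> C / real n + e / 2"
    using assms(2)[of "e / 2"] by auto
  have "(\<lambda>n. C / real n + e / 2) \<longlonglongrightarrow> 0 + e / 2"
    by (intro tendsto_intros lim_const_over_n)
  then have *: "eventually (\<lambda>n. C / real n + e / 2 < e) sequentially"
    by (rule order_tendstoD(2)) (use \<open>0 < e\<close> in auto)
  show "eventually (\<lambda>n. u n < e) sequentially"
    using * eventually_gt_at_top[of 0]
  proof eventually_elim
    case (elim n)
    then show ?case using C[of n] by simp
  qed
qed (use assms(1) in \<open>auto intro!: always_eventually elim: less_le_trans\<close>)

lemma average_tendsto_0:
  fixes b :: "nat \<Rightarrow> real"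
  assumes "\<And>n. 0 \<le> b n" "b \<longlonglongrightarrow> 0"
  shows "(\<lambda>n. 1 / real n * (\<Sum>k=1..n. b k)) \<longlonglongrightarrow> 0"
proof (rule tendsto_0_if_le_inverse)
  show "0 \<le> 1 / real n * (\<Sum>k=1..n. b k)" for n
    using assms(1) by (simp add: sum_nonneg)
  fix e :: real assume "0 < e"
  then obtain N where N: "\<And>n. n \<ge> N \<Longrightarrow> b n < e"
    using order_tendstoD(2)[OF assms(2)] unfolding eventually_sequentially by blast
  have "1 / real n * (\<Sum>k=1..n. b k) \<le> (\<Sum>k<N. b k) / real n + e" if "n > 0" for n
  proof -
    have "(\<Sum>k=1..n. b k) \<le> (\<Sum>k=1..n. (if k < N then b k else 0) + e)"
      using N \<open>0 < e\<close> by (intro sum_mono) (auto simp: not_less less_imp_le)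
    also have "\<dots> = (\<Sum>k\<in>{1..n} \<inter> {k. k < N}. b k) + real n * e"
      by (simp add: sum.distrib sum.inter_restrict)
    also have "(\<Sum>k\<in>{1..n} \<inter> {k. k < N}. b k) \<le> (\<Sum>k<N. b k)"
      using assms(1) by (intro sum_mono2) auto
    finally show ?thesis using that by (simp add: field_simps)
  qed
  then show "\<exists>C. \<forall>n>0. 1 / real n * (\<Sum>k=1..n. b k) \<le> C / real n + e" by blast
qed

lemma square_sum_le:
  fixes y :: "nat \<Rightarrow> real"
  shows "(\<Sum>k\<in>I. y k)\<^sup>2 \<le> real (card I) * (\<Sum>k\<in>I. (y k)\<^sup>2)"
  using sum_squared_le_sum_of_squares[of y I] by (cases "finite I") (auto simp: mult.commute)

text \<open>Cauchy--Schwarz alone gives only $(y_1 + \dots + y_n)^2 = O(n)$. Applying it separately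
  to the indices below and from \<open>N\<close> on replaces the constant by a small tail.\<close>

lemma square_sum_over_n_tendsto_0:
  fixes y :: "nat \<Rightarrow> real"
  assumes "summable (\<lambda>k. (y k)\<^sup>2)"
  shows "(\<lambda>n. 1 / real n * (\<Sum>k=1..n. y k)\<^sup>2) \<longlonglongrightarrow> 0"
proof (rule tendsto_0_if_le_inverse)
  fix e :: real assume "0 < e"
  then obtain N where "tail (\<lambda>k. (y k)\<^sup>2) N < e / 2"
    using order_tendstoD(2)[OF tail_tendsto_0[OF assms], of "e / 2"]
    by (auto dest: eventually_happens)
  define C where "C = 2 * real N * (\<Sum>k<N. (y k)\<^sup>2)"
  have "1 / real n * (\<Sum>k=1..n. y k)\<^sup>2 \<le> C / real n + e" if "n > 0" for n
  proof -
    let ?I = "{1..n} \<inter> {..<N}" and ?J = "{1..n} - {..<N}"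
    have "(\<Sum>k\<in>?I. y k)\<^sup>2 \<le> real (card ?I) * (\<Sum>k\<in>?I. (y k)\<^sup>2)"
      by (rule square_sum_le)
    also have "\<dots> \<le> real N * (\<Sum>k<N. (y k)\<^sup>2)"
      using card_mono[of "{..<N}" ?I] by (intro mult_mono sum_mono2) (auto intro: sum_nonneg)
    finally have I: "(\<Sum>k\<in>?I. y k)\<^sup>2 \<le> C / 2" by (simp add: C_def)
    have "(\<Sum>k\<in>?J. y k)\<^sup>2 \<le> real (card ?J) * (\<Sum>k\<in>?J. (y k)\<^sup>2)"
      by (rule square_sum_le)
    also have "\<dots> \<le> real n * (\<Sum>k=N..<Suc n. (y k)\<^sup>2)"
      using card_mono[of "{1..n}" ?J] by (intro mult_mono sum_mono2) (auto intro: sum_nonneg)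
    also have "\<dots> \<le> real n * (e / 2)"
      using sum_le_tail[OF assms, of N "Suc n"] \<open>tail _ N < e / 2\<close>
      by (intro mult_left_mono) auto
    finally have J: "(\<Sum>k\<in>?J. y k)\<^sup>2 \<le> real n * (e / 2)" .
    have "(\<Sum>k=1..n. y k) = (\<Sum>k\<in>?I. y k) + (\<Sum>k\<in>?J. y k)"
      by (rule sum.Int_Diff) simp
    then have "(\<Sum>k=1..n. y k)\<^sup>2 \<le> 2 * (\<Sum>k\<in>?I. y k)\<^sup>2 + 2 * (\<Sum>k\<in>?J. y k)\<^sup>2"
      using sum_squares_bound[of "\<Sum>k\<in>?I. y k" "\<Sum>k\<in>?J. y k"] by (simp add: power2_sum)
    also have "\<dots> \<le> C + real n * e" using I J by simp
    finally show ?thesis using that by (simp add: field_simps)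
  qed
  then show "\<exists>C. \<forall>n>0. 1 / real n * (\<Sum>k=1..n. y k)\<^sup>2 \<le> C / real n + e" by blast
qed simp

section \<open>Semi-linear processes\<close>

locale semi_linear = iid_path M for M :: "'a measure" +
  fixes \<alpha> :: "nat \<Rightarrow> 'a \<Rightarrow> real" and X :: "int \<Rightarrow> (int \<Rightarrow> 'a) \<Rightarrow> real"
  assumes process: "semi_linear_process M \<alpha> X"
begin

definition "coeff_var j = (\<integral>x. (\<alpha> j x)\<^sup>2 \<partial>M)"
definition "coeff_sum m x = (\<Sum>j<m. \<alpha> j x)"

text \<open>Taking the conditional expectation itself, and not the series $\sum_{j \ge k} \alpha_j
  \circ \pi_{k-j}$ that represents it in $L^2$, makes this function $F_0$-measurable and not merely
  equal to such a function almost surely.\<close>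

definition "past_mean k = real_cond_exp \<P> \<F> (X (int k))"

text \<open>For a martingale increment \<open>D\<close> the error $S_n - \sum_{k=1}^n D \circ T^k$
  is the sum of its conditional expectation \<open>past_error\<close> given $F_0$ and of
  \<open>fresh_error\<close>, which carries the innovations at times $1, \dots, n$.\<close>

definition "past_error n \<omega> = (\<Sum>k=1..n. past_mean k \<omega>)"
definition "fresh_error D n \<omega> = (\<Sum>i=1..n. coeff_sum (Suc n - i) (\<omega> (int i)) - D (shift (int i) \<omega>))"
definition "coeff_gap D m = (\<integral>\<omega>. (coeff_sum m (\<omega> 0) - D \<omega>)\<^sup>2 \<partial>\<P>)"

lemma square_integrable_coeff: "square_integrable M (\<alpha> j)"
  and integral_coeff: "(\<integral>x. \<alpha> j x \<partial>M) = 0"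
  and summable_norm2_coeff: "summable (\<lambda>j. (norm2 M (\<alpha> j))\<^sup>2)"
  and X_0_L2_sums: "L2_sums \<P> (\<lambda>j. coord_fun \<alpha> j \<circ> shift (- int j)) (X 0)"
  and X_eq_shift: "X i = X 0 \<circ> shift i"
  using process unfolding semi_linear_process_def by blast+

lemma summable_coeff_var: "summable coeff_var"
  using summable_norm2_coeff by (simp add: norm2_sq coeff_var_def[abs_def])

lemma coeff_var_nonneg: "0 \<le> coeff_var j"
  by (simp add: coeff_var_def)

lemma square_integrable_coeff_sum: "square_integrable M (coeff_sum m)"
  unfolding coeff_sum_def[abs_def] by (intro square_integrable_sum square_integrable_coeff)

lemma integral_coeff_sum: "(\<integral>x. coeff_sum m x \<partial>M) = 0"
  unfolding coeff_sum_def using square_integrable_integrable[OF square_integrable_coeff]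
  by (simp add: integral_coeff)

lemma square_integrable_X: "square_integrable \<P> (X i)"
proof -
  have "square_integrable \<P> (X 0)"
    using X_0_L2_sums by (simp add: L2_sums_def)
  then show ?thesis
    unfolding X_eq_shift[of i] comp_def by (rule square_integrable_shift)
qed

lemma X_L2_series:
  "(\<lambda>n. \<integral>\<omega>. ((\<Sum>j<n. \<alpha> j (\<omega> (i - int j))) - X i \<omega>)\<^sup>2 \<partial>\<P>) \<longlonglongrightarrow> 0"
proof -
  let ?f = "\<lambda>n \<omega>. ((\<Sum>j<n. \<alpha> j (\<omega> (- int j))) - X 0 \<omega>)\<^sup>2"
  have "(\<lambda>n. \<integral>\<omega>. ?f n \<omega> \<partial>\<P>) \<longlonglongrightarrow> 0"
    using X_0_L2_sums by (simp add: L2_sums_iff coord_fun_def shift_def)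
  moreover have "(\<integral>\<omega>. ?f n \<omega> \<partial>\<P>) = (\<integral>\<omega>. ?f n (shift i \<omega>) \<partial>\<P>)" for n
  proof (rule integral_shift[symmetric])
    have "\<alpha> j \<in> borel_measurable M" for j
      using square_integrable_coeff by (simp add: square_integrable_def)
    then have "(\<lambda>\<omega>. \<alpha> j (\<omega> k)) \<in> borel_measurable \<P>" for j k
      by (rule measurable_compose[OF coordinate_measurable])
    then show "?f n \<in> borel_measurable \<P>"
      using square_integrable_X[of 0] by (auto simp: square_integrable_def)
  qed
  moreover have "?f n (shift i \<omega>) = ((\<Sum>j<n. \<alpha> j (\<omega> (i - int j))) - X i \<omega>)\<^sup>2" for n \<omega>
    unfolding X_eq_shift[of i] by (simp add: shift_def)
  ultimately show ?thesis by simp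
qed

lemma integral_square_coordinate_sum:
  assumes "finite J"
  shows "(\<integral>\<omega>. (\<Sum>j\<in>J. \<alpha> j (\<omega> (i - int j)))\<^sup>2 \<partial>\<P>) = (\<Sum>j\<in>J. coeff_var j)"
proof -
  have "(\<integral>\<omega>. (\<Sum>j\<in>J. \<alpha> j (shift (i - int j) \<omega> 0))\<^sup>2 \<partial>\<P>) = (\<Sum>j\<in>J. \<integral>\<omega>. (\<alpha> j (\<omega> 0))\<^sup>2 \<partial>\<P>)"
    by (rule integral_square_sum_increments[OF assms])
      (auto simp: inj_on_def intro!: MA_increment_coordinate square_integrable_coeff integral_coeff)
  also have "\<dots> = (\<Sum>j\<in>J. coeff_var j)"
    using square_integrable_coeff unfolding coeff_var_def
    by (intro sum.cong refl integral_coordinate) (auto simp: square_integrable_def)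
  finally show ?thesis by (simp add: shift_def)
qed

text \<open>The terms with $j < k$ live on coordinates at times $1, \dots, k$, are centred and
  independent of $F_0$, so conditioning kills them. The remaining terms form a series of
  $F_0$-measurable functions converging in $L^2$, so conditioning leaves its sum unchanged; its
  squared norm is the tail of the variances by orthogonality.\<close>

lemma
  shows X_eq_cond_exp_plus: "AE \<omega> in \<P>. X (int k) \<omega> = past_mean k \<omega> + (\<Sum>j<k. \<alpha> j (\<omega> (int k - int j)))"
    and integral_past_mean_square: "(\<integral>\<omega>. (past_mean k \<omega>)\<^sup>2 \<partial>\<P>) = tail coeff_var k"
proof -
  let ?c = "\<lambda>j \<omega>. \<alpha> j (\<omega> (int k - int j))"
  define U where "U \<omega> = X (int k) \<omega> - (\<Sum>j<k. ?c j \<omega>)" for \<omega>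
  define Z where "Z n \<omega> = (\<Sum>j=k..<k+n. ?c j \<omega>)" for n \<omega>
  have c: "square_integrable \<P> (?c j)" for j
    by (intro square_integrable_coordinate square_integrable_coeff)
  have U: "square_integrable \<P> U"
    unfolding U_def[abs_def] by (intro square_integrable_diff square_integrable_X square_integrable_sum c)
  have Z: "square_integrable \<P> (Z n)" for n
    unfolding Z_def[abs_def] by (intro square_integrable_sum c)
  have ZF: "Z n \<in> borel_measurable \<F>" for n
    unfolding Z_def[abs_def] past_eq_coord_sigma
    using square_integrable_coeff
    by (intro borel_measurable_sum measurable_compose[OF coordinate_measurable_coord_sigma])
      (auto simp: square_integrable_def)
  have "(\<lambda>n. \<integral>\<omega>. ((\<Sum>j<n+k. ?c j \<omega>) - X (int k) \<omega>)\<^sup>2 \<partial>\<P>) \<longlonglongrightarrow> 0"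
    by (rule LIMSEQ_ignore_initial_segment[OF X_L2_series])
  moreover have "(\<Sum>j<n+k. ?c j \<omega>) = (\<Sum>j<k. ?c j \<omega>) + Z n \<omega>" for n \<omega>
    unfolding Z_def by (subst lessThan_atLeast0, subst lessThan_atLeast0, subst sum.atLeastLessThan_concat)
      (auto simp: add.commute)
  then have "(\<Sum>j<n+k. ?c j \<omega>) - X (int k) \<omega> = Z n \<omega> - U \<omega>" for n \<omega>
    by (simp add: U_def)
  ultimately have lim: "(\<lambda>n. \<integral>\<omega>. (Z n \<omega> - U \<omega>)\<^sup>2 \<partial>\<P>) \<longlonglongrightarrow> 0"
    by simp
  have EU: "AE \<omega> in \<P>. real_cond_exp \<P> \<F> U \<omega> = U \<omega>"
    by (rule P.cond_exp_L2_limit[OF ZF Z U lim])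
  have Ec: "AE \<omega> in \<P>. real_cond_exp \<P> \<F> (\<lambda>\<omega>. \<Sum>j<k. ?c j \<omega>) \<omega> = (\<integral>\<omega>. (\<Sum>j<k. ?c j \<omega>) \<partial>\<P>)"
    using square_integrable_coeff
    by (intro cond_exp_future P.square_integrable_integrable square_integrable_sum c borel_measurable_sum
        measurable_compose[OF coordinate_measurable_coord_sigma])
      (auto simp: square_integrable_def)
  have "(\<integral>\<omega>. ?c j \<omega> \<partial>\<P>) = 0" for j
    using square_integrable_coeff by (subst integral_coordinate) (auto simp: square_integrable_def integral_coeff)
  then have c0: "(\<integral>\<omega>. (\<Sum>j<k. ?c j \<omega>) \<partial>\<P>) = 0"
    using P.square_integrable_integrable[OF c] by simp
  have "AE \<omega> in \<P>. real_cond_exp \<P> \<F> U \<omega> =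
      real_cond_exp \<P> \<F> (X (int k)) \<omega> - real_cond_exp \<P> \<F> (\<lambda>\<omega>. \<Sum>j<k. ?c j \<omega>) \<omega>"
    unfolding U_def[abs_def]
    by (intro P.real_cond_exp_diff P.square_integrable_integrable square_integrable_sum c square_integrable_X)
  with EU Ec have YU: "AE \<omega> in \<P>. past_mean k \<omega> = U \<omega>"
    unfolding past_mean_def c0 by eventually_elim linarith
  then show "AE \<omega> in \<P>. X (int k) \<omega> = past_mean k \<omega> + (\<Sum>j<k. ?c j \<omega>)"
    by eventually_elim (simp add: U_def)
  have "(\<integral>\<omega>. (past_mean k \<omega>)\<^sup>2 \<partial>\<P>) = (\<integral>\<omega>. (U \<omega>)\<^sup>2 \<partial>\<P>)"
    using YU U by (intro integral_cong_AE) (auto simp: past_mean_def square_integrable_def)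
  moreover have "(\<lambda>n. \<integral>\<omega>. (Z n \<omega>)\<^sup>2 \<partial>\<P>) \<longlonglongrightarrow> (\<integral>\<omega>. (U \<omega>)\<^sup>2 \<partial>\<P>)"
    by (rule integral_square_tendsto[OF Z U lim])
  moreover have "(\<integral>\<omega>. (Z n \<omega>)\<^sup>2 \<partial>\<P>) = (\<Sum>j<n. coeff_var (j + k))" for n
    unfolding Z_def using sum.shift_bounds_nat_ivl[of coeff_var 0 k n]
    by (simp add: integral_square_coordinate_sum atLeast0LessThan add.commute)
  moreover have "(\<lambda>n. \<Sum>j<n. coeff_var (j + k)) \<longlonglongrightarrow> tail coeff_var k"
    unfolding tail_def by (intro summable_LIMSEQ) (simp add: summable_iff_shift summable_coeff_var)
  ultimately show "(\<integral>\<omega>. (past_mean k \<omega>)\<^sup>2 \<partial>\<P>) = tail coeff_var k"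
    by (simp add: LIMSEQ_unique)
qed

lemma square_integrable_past_mean: "square_integrable \<P> (past_mean k)"
  unfolding past_mean_def by (intro P.cond_exp_square_le square_integrable_X)

lemma square_integrable_past_error: "square_integrable \<P> (past_error n)"
  unfolding past_error_def[abs_def] by (intro square_integrable_sum square_integrable_past_mean)

text \<open>The substitution $i = k - j$ collects the terms that depend on the coordinate at time
  $i$.\<close>

lemma sum_coordinates_reindex:
  fixes u :: "nat \<Rightarrow> int \<Rightarrow> real"
  shows "(\<Sum>k=1..n. \<Sum>j<k. u j (int k - int j)) = (\<Sum>i=1..n. \<Sum>j<Suc n - i. u j (int i))"
proof -
  have "(\<Sum>k=1..n. \<Sum>j<k. u j (int k - int j)) = (\<Sum>(k, j)\<in>(SIGMA k:{1..n}. {..<k}). u j (int k - int j))"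
    by (rule sum.Sigma) auto
  also have "\<dots> = (\<Sum>(i, j)\<in>(SIGMA i:{1..n}. {..<Suc n - i}). u j (int i))"
    by (rule sum.reindex_bij_witness[of _ "\<lambda>(i, j). (i + j, j)" "\<lambda>(k, j). (k - j, j)"])
      (auto simp: of_nat_diff)
  also have "\<dots> = (\<Sum>i=1..n. \<Sum>j<Suc n - i. u j (int i))"
    by (rule sum.Sigma[symmetric]) auto
  finally show ?thesis .
qed

lemma MA_error_decomposition: "AE \<omega> in \<P>. MA_error X D n \<omega> = past_error n \<omega> + fresh_error D n \<omega>"
proof -
  have "AE \<omega> in \<P>. \<forall>k. X (int k) \<omega> = past_mean k \<omega> + (\<Sum>j<k. \<alpha> j (\<omega> (int k - int j)))"
    unfolding AE_all_countable by (intro allI X_eq_cond_exp_plus)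
  then show ?thesis
  proof eventually_elim
    case (elim \<omega>)
    then have "partial_sum X n \<omega> = past_error n \<omega> + (\<Sum>k=1..n. \<Sum>j<k. \<alpha> j (\<omega> (int k - int j)))"
      by (simp add: partial_sum_def past_error_def sum.distrib)
    then show ?case
      using sum_coordinates_reindex[of "\<lambda>j i. \<alpha> j (\<omega> i)" n]
      by (simp add: MA_error_def fresh_error_def coeff_sum_def sum_subtractf)
  qed
qed

lemma square_integrable_MA_error:
  assumes "square_integrable \<P> D"
  shows "square_integrable \<P> (MA_error X D n)"
  unfolding MA_error_def[abs_def] partial_sum_def
  by (intro square_integrable_diff square_integrable_sum square_integrable_X square_integrable_shift assms)

lemma square_integrable_fresh_error:
  assumes "square_integrable \<P> D"
  shows "square_integrable \<P> (fresh_error D n)"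
  unfolding fresh_error_def[abs_def]
  by (intro square_integrable_sum square_integrable_diff square_integrable_shift assms
      square_integrable_coordinate square_integrable_coeff_sum)

text \<open>Orthogonality of increments; reversing the index turns $n + 1 - i$ into $m$.\<close>

lemma integral_fresh_error_square:
  assumes "MA_increment M D"
  shows "(\<integral>\<omega>. (fresh_error D n \<omega>)\<^sup>2 \<partial>\<P>) = (\<Sum>m=1..n. coeff_gap D m)"
proof -
  have "(\<integral>\<omega>. (\<Sum>i=1..n. coeff_sum (Suc n - i) (shift (int i) \<omega> 0) - D (shift (int i) \<omega>))\<^sup>2 \<partial>\<P>)
      = (\<Sum>i=1..n. coeff_gap D (Suc n - i))"
    unfolding coeff_gap_def
    by (rule integral_square_sum_increments)
      (auto simp: inj_on_def intro!: MA_increment_diff MA_increment_coordinate assms square_integrable_coeff_sum integral_coeff_sum)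
  also have "\<dots> = (\<Sum>m=1..n. coeff_gap D m)"
    by (rule sum.reindex_bij_witness[of _ "\<lambda>i. Suc n - i" "\<lambda>i. Suc n - i"]) auto
  finally show ?thesis by (simp add: fresh_error_def shift_def)
qed

lemma L2_sums_coord_fun_iff:
  "L2_sums \<P> (coord_fun \<alpha>) D \<longleftrightarrow> square_integrable \<P> D \<and> coeff_gap D \<longlonglongrightarrow> 0"
proof -
  have "square_integrable \<P> (coord_fun \<alpha> i)" for i
    unfolding coord_fun_def comp_def by (intro square_integrable_coordinate square_integrable_coeff)
  then show ?thesis
    by (simp add: L2_sums_iff coeff_gap_def[abs_def] coeff_sum_def coord_fun_def)
qed

lemma summable_cond_exp_iff_tail:
  "summable (\<lambda>k::nat. (norm2 \<P> (real_cond_exp \<P> \<F> (X (int k))))\<^sup>2) \<longleftrightarrow> summable (tail coeff_var)"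
  using integral_past_mean_square by (simp add: norm2_sq past_mean_def[abs_def])

lemma summable_cond_exp_iff:
  "summable (\<lambda>k::nat. (norm2 \<P> (real_cond_exp \<P> \<F> (X (int k))))\<^sup>2)
     \<longleftrightarrow> summable (\<lambda>j. real j * (norm2 M (\<alpha> j))\<^sup>2)"
  using summable_cond_exp_iff_tail summable_tail_iff[OF summable_coeff_var coeff_var_nonneg]
  by (simp add: norm2_sq coeff_var_def)

text \<open>The function $\sum_k E(X_k \mid F_0)^2$ serves twice: it is almost surely finite, which
  gives the pointwise limit, and it is an integrable bound for $R_n^2/n$ by Cauchy--Schwarz.\<close>

lemma
  assumes "summable (tail coeff_var)"
  shows past_error_AE: "AE \<omega> in \<P>. (\<lambda>n. 1 / real n * (past_error n \<omega>)\<^sup>2) \<longlonglongrightarrow> 0"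
    and past_error_L1: "(\<lambda>n. 1 / real n * (\<integral>\<omega>. (past_error n \<omega>)\<^sup>2 \<partial>\<P>)) \<longlonglongrightarrow> 0"
proof -
  have Y2: "integrable \<P> (\<lambda>\<omega>. (past_mean k \<omega>)\<^sup>2)" for k
    using square_integrable_past_mean by (simp add: square_integrable_def)
  then have [measurable]: "(\<lambda>\<omega>. (past_mean k \<omega>)\<^sup>2) \<in> borel_measurable \<P>" for k by auto
  have "(\<integral>\<^sup>+\<omega>. (\<Sum>k. ennreal ((past_mean k \<omega>)\<^sup>2)) \<partial>\<P>) = (\<Sum>k. \<integral>\<^sup>+\<omega>. ennreal ((past_mean k \<omega>)\<^sup>2) \<partial>\<P>)"
    by (rule nn_integral_suminf) measurable
  also have "\<dots> = (\<Sum>k. ennreal (tail coeff_var k))"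
    using Y2 by (simp add: nn_integral_eq_integral integral_past_mean_square)
  also have "\<dots> = ennreal (suminf (tail coeff_var))"
    by (intro suminf_ennreal2 tail_nonneg summable_coeff_var coeff_var_nonneg assms)
  finally have "AE \<omega> in \<P>. (\<Sum>k. ennreal ((past_mean k \<omega>)\<^sup>2)) \<noteq> \<infinity>"
    by (intro nn_integral_PInf_AE) auto
  then have sm: "AE \<omega> in \<P>. summable (\<lambda>k. (past_mean k \<omega>)\<^sup>2)"
    by eventually_elim (auto intro: summable_suminf_not_top)
  then show AE: "AE \<omega> in \<P>. (\<lambda>n. 1 / real n * (past_error n \<omega>)\<^sup>2) \<longlonglongrightarrow> 0"
    unfolding past_error_def by eventually_elim (rule square_sum_over_n_tendsto_0)
  have W: "integrable \<P> (\<lambda>\<omega>. \<Sum>k. (past_mean k \<omega>)\<^sup>2)"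
    using sm assms by (intro integrable_suminf Y2) (auto simp: integral_past_mean_square)
  have "(\<lambda>n. \<integral>\<omega>. 1 / real n * (past_error n \<omega>)\<^sup>2 \<partial>\<P>) \<longlonglongrightarrow> (\<integral>\<omega>. 0 \<partial>\<P>)"
  proof (rule integral_dominated_convergence[OF _ _ W AE])
    show "(\<lambda>\<omega>. 1 / real n * (past_error n \<omega>)\<^sup>2) \<in> borel_measurable \<P>" for n
      using square_integrable_past_error[of n]
      by (intro borel_measurable_times borel_measurable_const borel_measurable_power)
        (simp add: square_integrable_def)
    show "AE \<omega> in \<P>. norm (1 / real n * (past_error n \<omega>)\<^sup>2) \<le> (\<Sum>k. (past_mean k \<omega>)\<^sup>2)" for n
      using sm
    proof eventually_elim
      case (elim \<omega>)
      have "(past_error n \<omega>)\<^sup>2 \<le> real n * (\<Sum>k=1..n. (past_mean k \<omega>)\<^sup>2)"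
        unfolding past_error_def using square_sum_le[of "\<lambda>k. past_mean k \<omega>" "{1..n}"] by simp
      also have "\<dots> \<le> real n * (\<Sum>k. (past_mean k \<omega>)\<^sup>2)"
        using elim by (intro mult_left_mono sum_le_suminf) auto
      finally show ?case
        using suminf_nonneg[OF elim] by (cases "n = 0") (auto simp: field_simps)
    qed
  qed simp
  then show "(\<lambda>n. 1 / real n * (\<integral>\<omega>. (past_error n \<omega>)\<^sup>2 \<partial>\<P>)) \<longlonglongrightarrow> 0"
    by simp
qed

text \<open>The conditional error is nonnegative, so its $L^1$-norm is the unconditional mean square
  error.\<close>

lemma L2_MA_if_L2_0_MA:
  assumes "L2_0_MA M X"
  shows "L2_MA M X"
proof -
  obtain D where D: "MA_increment M D"
      "(\<lambda>n. \<integral>\<omega>. \<bar>cond_MA_error M X D n \<omega>\<bar> \<partial>\<P>) \<longlonglongrightarrow> 0"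
    using assms by (auto simp: L2_0_MA_def)
  have "(\<integral>\<omega>. \<bar>cond_MA_error M X D n \<omega>\<bar> \<partial>\<P>) = 1 / real n * (norm2 \<P> (MA_error X D n))\<^sup>2" for n
  proof -
    let ?f = "\<lambda>\<omega>. (MA_error X D n \<omega>)\<^sup>2"
    have f: "integrable \<P> ?f"
      using square_integrable_MA_error D(1) by (auto simp: square_integrable_def MA_increment_def)
    then have "AE \<omega> in \<P>. 0 \<le> real_cond_exp \<P> \<F> ?f \<omega>"
      by (intro P.real_cond_exp_pos) auto
    then have "AE \<omega> in \<P>. \<bar>cond_MA_error M X D n \<omega>\<bar> = 1 / real n * real_cond_exp \<P> \<F> ?f \<omega>"
      by eventually_elim (simp add: cond_MA_error_def)
    then have "(\<integral>\<omega>. \<bar>cond_MA_error M X D n \<omega>\<bar> \<partial>\<P>) = (\<integral>\<omega>. 1 / real n * real_cond_exp \<P> \<F> ?f \<omega> \<partial>\<P>)"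
      by (intro integral_cong_AE) (auto simp: cond_MA_error_def[abs_def])
    also have "\<dots> = 1 / real n * (norm2 \<P> (MA_error X D n))\<^sup>2"
      using P.real_cond_exp_int(2)[OF f] by (simp add: norm2_sq)
    finally show ?thesis .
  qed
  then show ?thesis using D by (auto simp: L2_MA_def L2_MA_with_def)
qed

text \<open>Slow variation of the partial sums on dyadic blocks: a sum of at most $n$ coefficients
  with indices $\ge n$ has squared norm at most $n \sum_{j \ge n} a_j$.\<close>

lemma coeff_gap_le:
  assumes D: "square_integrable \<P> D" and "n \<le> m" "m \<le> 2 * n"
  shows "coeff_gap D n \<le> 2 * coeff_gap D m + 2 * (real n * tail coeff_var n)"
proof -
  let ?v = "\<lambda>\<omega>. - (\<Sum>j=n..<m. \<alpha> j (\<omega> 0))"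
  have c: "square_integrable \<P> (\<lambda>\<omega>. \<alpha> j (\<omega> 0))" for j
    by (intro square_integrable_coordinate square_integrable_coeff)
  have v: "square_integrable \<P> ?v"
    using square_integrable_cmult[OF square_integrable_sum[of "{n..<m}" \<P>, OF c], of "-1"] by simp
  have "coeff_sum m x = coeff_sum n x + (\<Sum>j=n..<m. \<alpha> j x)" for x
    unfolding coeff_sum_def lessThan_atLeast0 using \<open>n \<le> m\<close> by (subst sum.atLeastLessThan_concat) auto
  then have "coeff_gap D n = (\<integral>\<omega>. ((coeff_sum m (\<omega> 0) - D \<omega>) + ?v \<omega>)\<^sup>2 \<partial>\<P>)"
    by (simp add: coeff_gap_def algebra_simps)
  also have "\<dots> \<le> 2 * coeff_gap D m + 2 * (\<integral>\<omega>. (?v \<omega>)\<^sup>2 \<partial>\<P>)"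
    unfolding coeff_gap_def
    by (intro integral_square_add_le v square_integrable_diff D square_integrable_coordinate square_integrable_coeff_sum)
  also have "(\<integral>\<omega>. (?v \<omega>)\<^sup>2 \<partial>\<P>) \<le> (\<integral>\<omega>. real (m - n) * (\<Sum>j=n..<m. (\<alpha> j (\<omega> 0))\<^sup>2) \<partial>\<P>)"
    using v c square_sum_le[of _ "{n..<m}"]
    by (intro integral_mono) (auto simp: square_integrable_def intro!: Bochner_Integration.integrable_sum)
  also have "\<dots> = real (m - n) * (\<Sum>j=n..<m. \<integral>\<omega>. (\<alpha> j (\<omega> 0))\<^sup>2 \<partial>\<P>)"
    using c by (simp add: square_integrable_def)
  also have "(\<Sum>j=n..<m. \<integral>\<omega>. (\<alpha> j (\<omega> 0))\<^sup>2 \<partial>\<P>) = (\<Sum>j=n..<m. coeff_var j)"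
    using square_integrable_coeff unfolding coeff_var_def
    by (intro sum.cong refl integral_coordinate) (auto simp: square_integrable_def)
  also have "real (m - n) * (\<Sum>j=n..<m. coeff_var j) \<le> real n * tail coeff_var n"
    using assms by (intro mult_mono sum_le_tail summable_coeff_var coeff_var_nonneg) (auto intro: sum_nonneg coeff_var_nonneg)
  finally show ?thesis by simp
qed

lemma coeff_gap_nonneg: "0 \<le> coeff_gap D n"
  by (simp add: coeff_gap_def)

text \<open>Subtracting the negligible past error leaves Cesaro convergence of \<open>coeff_gap
  D\<close> to $0$. Averaging \<open>coeff_gap_le\<close> over $m \in \{n+1, \dots, 2n\}$ bounds
  \<open>coeff_gap D n\<close> itself by a Cesaro mean plus $2 n \sum_{j \ge n} a_j$, and both
  vanish in the limit.\<close>

lemma L2_sums_if_L2_MA_with: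
  assumes t: "summable (tail coeff_var)" and MA: "L2_MA_with M X D"
  shows "L2_sums \<P> (coord_fun \<alpha>) D"
proof -
  have inc: "MA_increment M D" and D: "square_integrable \<P> D"
    and lim: "(\<lambda>n. 1 / real n * (\<integral>\<omega>. (MA_error X D n \<omega>)\<^sup>2 \<partial>\<P>)) \<longlonglongrightarrow> 0"
    using MA by (auto simp: L2_MA_with_def MA_increment_def norm2_sq)
  have le: "(\<Sum>m=1..n. coeff_gap D m)
      \<le> 2 * (\<integral>\<omega>. (MA_error X D n \<omega>)\<^sup>2 \<partial>\<P>) + 2 * (\<integral>\<omega>. (past_error n \<omega>)\<^sup>2 \<partial>\<P>)" for n
  proof -
    have E: "square_integrable \<P> (MA_error X D n)" by (rule square_integrable_MA_error[OF D])
    have mR: "square_integrable \<P> (\<lambda>\<omega>. - past_error n \<omega>)"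
      using square_integrable_cmult[OF square_integrable_past_error, of "-1"] by simp
    have "AE \<omega> in \<P>. (fresh_error D n \<omega>)\<^sup>2 = (MA_error X D n \<omega> + - past_error n \<omega>)\<^sup>2"
      using MA_error_decomposition[of D n] by eventually_elim simp
    then have "(\<Sum>m=1..n. coeff_gap D m) = (\<integral>\<omega>. (MA_error X D n \<omega> + - past_error n \<omega>)\<^sup>2 \<partial>\<P>)"
      unfolding integral_fresh_error_square[OF inc, symmetric]
      using square_integrable_fresh_error[OF D] square_integrable_add[OF E mR]
      by (intro integral_cong_AE) (auto simp: square_integrable_def)
    also have "\<dots> \<le> 2 * (\<integral>\<omega>. (MA_error X D n \<omega>)\<^sup>2 \<partial>\<P>) + 2 * (\<integral>\<omega>. (- past_error n \<omega>)\<^sup>2 \<partial>\<P>)"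
      by (rule integral_square_add_le[OF E mR])
    finally show ?thesis by simp
  qed
  have avg: "(\<lambda>n. 1 / real n * (\<Sum>m=1..n. coeff_gap D m)) \<longlonglongrightarrow> 0"
  proof (rule tendsto_sandwich[OF _ _ tendsto_const])
    show "(\<lambda>n. 2 * (1 / real n * (\<integral>\<omega>. (MA_error X D n \<omega>)\<^sup>2 \<partial>\<P>))
        + 2 * (1 / real n * (\<integral>\<omega>. (past_error n \<omega>)\<^sup>2 \<partial>\<P>))) \<longlonglongrightarrow> 0"
      using tendsto_add[OF tendsto_mult_right_zero[OF lim, of 2] tendsto_mult_right_zero[OF past_error_L1[OF t], of 2]]
      by simp
    show "\<forall>\<^sub>F n in sequentially. 1 / real n * (\<Sum>m=1..n. coeff_gap D m)
        \<le> 2 * (1 / real n * (\<integral>\<omega>. (MA_error X D n \<omega>)\<^sup>2 \<partial>\<P>)) + 2 * (1 / real n * (\<integral>\<omega>. (past_error n \<omega>)\<^sup>2 \<partial>\<P>))"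
    proof (rule always_eventually, rule allI)
      fix n
      show "1 / real n * (\<Sum>m=1..n. coeff_gap D m)
        \<le> 2 * (1 / real n * (\<integral>\<omega>. (MA_error X D n \<omega>)\<^sup>2 \<partial>\<P>)) + 2 * (1 / real n * (\<integral>\<omega>. (past_error n \<omega>)\<^sup>2 \<partial>\<P>))"
        using mult_left_mono[OF le[of n], of "1 / real n"] by (simp add: algebra_simps)
    qed
  qed (auto simp: sum_nonneg coeff_gap_nonneg)
  have sj: "summable (\<lambda>j. real j * coeff_var j)"
    using t summable_tail_iff[OF summable_coeff_var coeff_var_nonneg] by simp
  have "coeff_gap D \<longlonglongrightarrow> 0"
  proof (rule tendsto_sandwich[OF _ _ tendsto_const])
    \<comment> \<open>The block has \<open>n\<close> elements while the mean runs over $2n$ indices and \<open>coeff_gap_le\<close> costs a factor $2$: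
      hence the constant $4$.\<close>
    have "filterlim (\<lambda>n::nat. 2 * n) sequentially sequentially"
      by (rule filterlim_subseq) (simp add: strict_mono_def)
    from filterlim_compose[OF avg this]
    have "(\<lambda>n. 1 / real (2 * n) * (\<Sum>m=1..2 * n. coeff_gap D m)) \<longlonglongrightarrow> 0" .
    from tendsto_add[OF tendsto_mult_right_zero[OF this, of 4]
        tendsto_mult_right_zero[OF mult_tail_tendsto_0[OF summable_coeff_var coeff_var_nonneg sj], of 2]]
    show "(\<lambda>n. 4 * (1 / real (2 * n) * (\<Sum>m=1..2 * n. coeff_gap D m)) + 2 * (real n * tail coeff_var n)) \<longlonglongrightarrow> 0"
      by simp
    show "\<forall>\<^sub>F n in sequentially. coeff_gap D n \<le> 4 * (1 / real (2 * n) * (\<Sum>m=1..2 * n. coeff_gap D m)) + 2 * (real n * tail coeff_var n)"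
      using eventually_gt_at_top[of 0]
    proof eventually_elim
      case (elim n)
      have "real n * coeff_gap D n = (\<Sum>m=n+1..2*n. coeff_gap D n)" by simp
      also have "\<dots> \<le> (\<Sum>m=n+1..2*n. 2 * coeff_gap D m + 2 * (real n * tail coeff_var n))"
        by (intro sum_mono coeff_gap_le D) auto
      also have "\<dots> = 2 * (\<Sum>m=n+1..2*n. coeff_gap D m) + real n * (2 * (real n * tail coeff_var n))"
        by (simp add: sum.distrib sum_distrib_left)
      also have "(\<Sum>m=n+1..2*n. coeff_gap D m) \<le> (\<Sum>m=1..2*n. coeff_gap D m)"
        by (intro sum_mono2) (auto simp: coeff_gap_nonneg)
      finally show ?case using elim by (simp add: field_simps)
    qed
  qed (auto simp: coeff_gap_nonneg)
  then show ?thesis using D by (simp add: L2_sums_coord_fun_iff)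
qed

text \<open>The sum of the series is given only as an arbitrary $L^2$-limit on the path space. Along
  a subsequence the partial sums converge almost surely, and the pointwise limit of the functions
  $B_{r(n)}$ on the state space is the required \<open>d\<close>.\<close>

lemma L2_sum_is_function_of_coordinate:
  assumes "L2_summable \<P> (coord_fun \<alpha>)"
  obtains d where "square_integrable M d" "(\<integral>x. d x \<partial>M) = 0" "coeff_gap (\<lambda>\<omega>. d (\<omega> 0)) \<longlonglongrightarrow> 0"
proof -
  obtain s where s: "square_integrable \<P> s" "coeff_gap s \<longlonglongrightarrow> 0"
    using assms by (auto simp: L2_summable_def L2_sums_coord_fun_iff)
  have Bm [measurable]: "coeff_sum m \<in> borel_measurable M" for m
    using square_integrable_coeff_sum by (simp add: square_integrable_def)
  have si: "square_integrable \<P> (\<lambda>\<omega>. coeff_sum m (\<omega> 0) - s \<omega>)" for m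
    by (intro square_integrable_diff square_integrable_coordinate square_integrable_coeff_sum s)
  have "\<exists>r::nat \<Rightarrow> nat. strict_mono r \<and> (AE \<omega> in \<P>. (\<lambda>n. (coeff_sum (r n) (\<omega> 0) - s \<omega>)\<^sup>2) \<longlonglongrightarrow> 0)"
    using si s(2) by (intro tendsto_L1_AE_subseq) (auto simp: square_integrable_def coeff_gap_def[abs_def])
  then obtain r :: "nat \<Rightarrow> nat" where r: "AE \<omega> in \<P>. (\<lambda>n. (coeff_sum (r n) (\<omega> 0) - s \<omega>)\<^sup>2) \<longlonglongrightarrow> 0"
    by blast
  define d where "d x = lim (\<lambda>n. coeff_sum (r n) x)" for x
  have d: "d \<in> borel_measurable M"
    unfolding d_def[abs_def] by (rule borel_measurable_lim_metric) measurable
  have ds: "AE \<omega> in \<P>. s \<omega> = d (\<omega> 0)"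
    using r
  proof eventually_elim
    case (elim \<omega>)
    then have "(\<lambda>n. coeff_sum (r n) (\<omega> 0) - s \<omega>) \<longlonglongrightarrow> 0"
      using tendsto_real_sqrt[OF elim] by (simp add: tendsto_rabs_zero_iff)
    then have "(\<lambda>n. coeff_sum (r n) (\<omega> 0)) \<longlonglongrightarrow> s \<omega>"
      by (rule LIM_zero_cancel)
    then show ?case by (simp add: d_def limI)
  qed
  have dm: "(\<lambda>\<omega>. d (\<omega> 0)) \<in> borel_measurable \<P>"
    by (rule measurable_compose[OF coordinate_measurable d])
  then have dP: "square_integrable \<P> (\<lambda>\<omega>. d (\<omega> 0))"
    using square_integrable_cong_AE[OF s(1) _ ds] by simp
  show ?thesis
  proof
    show "square_integrable M d"
      unfolding square_integrable_def
    proof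
      have "integrable (distr \<P> M (\<lambda>\<omega>. \<omega> 0)) (\<lambda>x. (d x)\<^sup>2)"
        using dP d by (subst integrable_distr_eq) (auto simp: square_integrable_def)
      then show "integrable M (\<lambda>x. (d x)\<^sup>2)" by (simp add: distr_coordinate)
    qed (rule d)
    have "AE \<omega> in \<P>. (coeff_sum m (\<omega> 0) - d (\<omega> 0))\<^sup>2 = (coeff_sum m (\<omega> 0) - s \<omega>)\<^sup>2" for m
      using ds by eventually_elim simp
    then have "coeff_gap (\<lambda>\<omega>. d (\<omega> 0)) = coeff_gap s"
      unfolding coeff_gap_def[abs_def] using dm s
      by (intro ext integral_cong_AE) (auto simp: square_integrable_def)
    then show lim: "coeff_gap (\<lambda>\<omega>. d (\<omega> 0)) \<longlonglongrightarrow> 0" using s by simp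
    have "(\<lambda>m. \<integral>\<omega>. 1 * (coeff_sum m (\<omega> 0) - d (\<omega> 0)) \<partial>\<P>) \<longlonglongrightarrow> 0"
      using lim unfolding coeff_gap_def
      by (intro integral_mult_tendsto_0 square_integrable_diff square_integrable_coordinate square_integrable_coeff_sum dP)
        (auto simp: square_integrable_def)
    moreover have "(\<integral>\<omega>. 1 * (coeff_sum m (\<omega> 0) - d (\<omega> 0)) \<partial>\<P>) = - (\<integral>x. d x \<partial>M)" for m
      using P.square_integrable_integrable[OF dP]
        P.square_integrable_integrable[OF square_integrable_coordinate[OF square_integrable_coeff_sum]]
      by (simp add: integral_coordinate d integral_coeff_sum)
    ultimately have "(\<lambda>m::nat. - (\<integral>x. d x \<partial>M)) \<longlonglongrightarrow> 0" by simp
    then show "(\<integral>x. d x \<partial>M) = 0" by (simp add: LIMSEQ_const_iff)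
  qed
qed

text \<open>With $D = d \circ \pi_0$ the fresh error is a function of the coordinates at times $1,
  \dots, n$, hence independent of $F_0$. In the expansion of the square the cross term vanishes
  because the fresh error is centred, and its square contributes a constant.\<close>

lemma cond_MA_error_eq:
  assumes d: "square_integrable M d" "(\<integral>x. d x \<partial>M) = 0"
  defines "D \<equiv> \<lambda>\<omega>. d (\<omega> 0)"
  shows "AE \<omega> in \<P>. cond_MA_error M X D n \<omega> = 1 / real n * (past_error n \<omega>)\<^sup>2 + 1 / real n * (\<Sum>m=1..n. coeff_gap D m)"
proof -
  let ?E = "real_cond_exp \<P> \<F>"
  have inc: "MA_increment M D" unfolding D_def by (intro MA_increment_coordinate d)
  then have D: "square_integrable \<P> D" by (simp add: MA_increment_def)
  have Qs: "square_integrable \<P> (fresh_error D n)" by (rule square_integrable_fresh_error[OF D])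
  have RF [measurable]: "past_error n \<in> borel_measurable \<F>"
    unfolding past_error_def[abs_def] past_mean_def by measurable
  have QF: "fresh_error D n \<in> borel_measurable (coord_sigma M {0<..})"
    using d square_integrable_coeff_sum unfolding fresh_error_def[abs_def] D_def shift_def
    by (intro borel_measurable_sum borel_measurable_diff measurable_compose[OF coordinate_measurable_coord_sigma])
      (auto simp: square_integrable_def)
  have i: "integrable \<P> (\<lambda>\<omega>. (past_error n \<omega>)\<^sup>2)" "integrable \<P> (\<lambda>\<omega>. (fresh_error D n \<omega>)\<^sup>2)"
      "integrable \<P> (\<lambda>\<omega>. past_error n \<omega> * fresh_error D n \<omega>)" "integrable \<P> (\<lambda>\<omega>. 2 * past_error n \<omega> * fresh_error D n \<omega>)" "integrable \<P> (fresh_error D n)"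
    using Qs square_integrable_past_error square_integrable_mult_integrable[OF square_integrable_past_error Qs]
      P.square_integrable_integrable[OF Qs]
    by (auto simp: square_integrable_def mult.assoc)
  have "(\<integral>\<omega>. fresh_error D n \<omega> \<partial>\<P>) = 0"
  proof -
    have 1: "integrable \<P> (\<lambda>\<omega>. coeff_sum m (\<omega> j))" "integrable \<P> (\<lambda>\<omega>. d (\<omega> j))" for m j
      by (intro P.square_integrable_integrable square_integrable_coordinate square_integrable_coeff_sum d)+
    have 2: "(\<integral>\<omega>. coeff_sum m (\<omega> j) \<partial>\<P>) = 0" "(\<integral>\<omega>. d (\<omega> j) \<partial>\<P>) = 0" for m j
      using d square_integrable_coeff_sum integral_coeff_sum by (auto simp: square_integrable_def integral_coordinate)
    show ?thesis
      unfolding fresh_error_def D_def shift_def using 1 2 by simp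
  qed
  with cond_exp_future[OF i(5) QF] have E1: "AE \<omega> in \<P>. ?E (fresh_error D n) \<omega> = 0" by simp
  have E2: "AE \<omega> in \<P>. ?E (\<lambda>\<omega>. (fresh_error D n \<omega>)\<^sup>2) \<omega> = (\<Sum>m=1..n. coeff_gap D m)"
    unfolding integral_fresh_error_square[OF inc, symmetric]
    by (rule cond_exp_future[OF i(2)]) (use QF in auto)
  have E3: "AE \<omega> in \<P>. ?E (\<lambda>\<omega>. (2 * past_error n \<omega>) * fresh_error D n \<omega>) \<omega> = (2 * past_error n \<omega>) * ?E (fresh_error D n) \<omega>"
    by (rule P.real_cond_exp_mult) (use i in \<open>auto simp: borel_measurable_integrable\<close>)
  have E4: "AE \<omega> in \<P>. ?E (\<lambda>\<omega>. (past_error n \<omega>)\<^sup>2) \<omega> = (past_error n \<omega>)\<^sup>2"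
    by (rule P.real_cond_exp_F_meas) (use i in auto)
  have E5: "AE \<omega> in \<P>. ?E (\<lambda>\<omega>. (past_error n \<omega>)\<^sup>2 + 2 * past_error n \<omega> * fresh_error D n \<omega>) \<omega> =
      ?E (\<lambda>\<omega>. (past_error n \<omega>)\<^sup>2) \<omega> + ?E (\<lambda>\<omega>. 2 * past_error n \<omega> * fresh_error D n \<omega>) \<omega>"
    by (intro P.real_cond_exp_add i)
  have E6: "AE \<omega> in \<P>. ?E (\<lambda>\<omega>. ((past_error n \<omega>)\<^sup>2 + 2 * past_error n \<omega> * fresh_error D n \<omega>) + (fresh_error D n \<omega>)\<^sup>2) \<omega> =
      ?E (\<lambda>\<omega>. (past_error n \<omega>)\<^sup>2 + 2 * past_error n \<omega> * fresh_error D n \<omega>) \<omega> + ?E (\<lambda>\<omega>. (fresh_error D n \<omega>)\<^sup>2) \<omega>"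
    by (intro P.real_cond_exp_add Bochner_Integration.integrable_add i)
  have "AE \<omega> in \<P>. ?E (\<lambda>\<omega>. (MA_error X D n \<omega>)\<^sup>2) \<omega> =
      ?E (\<lambda>\<omega>. ((past_error n \<omega>)\<^sup>2 + 2 * past_error n \<omega> * fresh_error D n \<omega>) + (fresh_error D n \<omega>)\<^sup>2) \<omega>"
  proof (rule P.real_cond_exp_cong)
    show "AE \<omega> in \<P>. (MA_error X D n \<omega>)\<^sup>2 = ((past_error n \<omega>)\<^sup>2 + 2 * past_error n \<omega> * fresh_error D n \<omega>) + (fresh_error D n \<omega>)\<^sup>2"
      using MA_error_decomposition[of D n] by eventually_elim (simp add: power2_sum)
    show "(\<lambda>\<omega>. (MA_error X D n \<omega>)\<^sup>2) \<in> borel_measurable \<P>"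
      using square_integrable_MA_error[OF D] by (auto simp: square_integrable_def)
    show "(\<lambda>\<omega>. ((past_error n \<omega>)\<^sup>2 + 2 * past_error n \<omega> * fresh_error D n \<omega>) + (fresh_error D n \<omega>)\<^sup>2) \<in> borel_measurable \<P>"
      by (intro borel_measurable_add borel_measurable_integrable i)
  qed
  with E1 E2 E3 E4 E5 E6 show ?thesis
    by eventually_elim (simp add: cond_MA_error_def distrib_left)
qed

lemma L2_0_MA_if_L2_summable:
  assumes t: "summable (tail coeff_var)" and "L2_summable \<P> (coord_fun \<alpha>)"
  shows "L2_0_MA M X"
proof -
  obtain d where d: "square_integrable M d" "(\<integral>x. d x \<partial>M) = 0" "coeff_gap (\<lambda>\<omega>. d (\<omega> 0)) \<longlonglongrightarrow> 0"
    using L2_sum_is_function_of_coordinate[OF assms(2)] .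
  define D :: "(int \<Rightarrow> 'a) \<Rightarrow> real" where "D = (\<lambda>\<omega>. d (\<omega> 0))"
  have inc: "MA_increment M D" unfolding D_def by (intro MA_increment_coordinate d)
  have eq: "AE \<omega> in \<P>. \<forall>n. cond_MA_error M X D n \<omega>
      = 1 / real n * (past_error n \<omega>)\<^sup>2 + 1 / real n * (\<Sum>m=1..n. coeff_gap D m)"
    unfolding AE_all_countable D_def by (intro allI cond_MA_error_eq d)
  have avg: "(\<lambda>n. 1 / real n * (\<Sum>m=1..n. coeff_gap D m)) \<longlonglongrightarrow> 0"
    using d(3) by (intro average_tendsto_0 coeff_gap_nonneg) (simp add: D_def)
  have "AE \<omega> in \<P>. (\<lambda>n. cond_MA_error M X D n \<omega>) \<longlonglongrightarrow> 0"
    using eq past_error_AE[OF t]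
  proof eventually_elim
    case (elim \<omega>)
    show ?case using tendsto_add[OF elim(2) avg] elim(1) by simp
  qed
  moreover have "(\<integral>\<omega>. \<bar>cond_MA_error M X D n \<omega>\<bar> \<partial>\<P>)
      = 1 / real n * (\<integral>\<omega>. (past_error n \<omega>)\<^sup>2 \<partial>\<P>) + 1 / real n * (\<Sum>m=1..n. coeff_gap D m)" for n
  proof -
    have R2: "integrable \<P> (\<lambda>\<omega>. (past_error n \<omega>)\<^sup>2)"
      using square_integrable_past_error by (simp add: square_integrable_def)
    have "AE \<omega> in \<P>. \<bar>cond_MA_error M X D n \<omega>\<bar> = 1 / real n * (past_error n \<omega>)\<^sup>2 + 1 / real n * (\<Sum>m=1..n. coeff_gap D m)"
      using eq by eventually_elim (simp add: sum_nonneg coeff_gap_nonneg)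
    then have "(\<integral>\<omega>. \<bar>cond_MA_error M X D n \<omega>\<bar> \<partial>\<P>)
        = (\<integral>\<omega>. 1 / real n * (past_error n \<omega>)\<^sup>2 + 1 / real n * (\<Sum>m=1..n. coeff_gap D m) \<partial>\<P>)"
      using R2 by (intro integral_cong_AE) (auto simp: cond_MA_error_def[abs_def])
    then show ?thesis using R2 by (simp add: P.prob_space)
  qed
  then have "(\<lambda>n. \<integral>\<omega>. \<bar>cond_MA_error M X D n \<omega>\<bar> \<partial>\<P>) \<longlonglongrightarrow> 0"
    using tendsto_add[OF past_error_L1[OF t] avg] by simp
  ultimately show ?thesis using inc by (auto simp: L2_0_MA_def)
qed

end

theorem proposition5p1:
  fixes M :: "'a measure"
    and \<alpha> :: "nat \<Rightarrow> 'a \<Rightarrow> real"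
    and X :: "int \<Rightarrow> (int \<Rightarrow> 'a) \<Rightarrow> real"
  assumes "semi_linear_process M \<alpha> X"
  shows
    "(summable (\<lambda>k::nat. (norm2 (path_space M) (real_cond_exp (path_space M) (past M 0) (X (int k))))\<^sup>2)
        \<longleftrightarrow> summable (\<lambda>j::nat. real j * (norm2 M (\<alpha> j))\<^sup>2)) \<and>
     (summable (\<lambda>k::nat. (norm2 (path_space M) (real_cond_exp (path_space M) (past M 0) (X (int k))))\<^sup>2)
        \<longrightarrow> (L2_MA M X \<longleftrightarrow> L2_0_MA M X) \<and>
            (L2_0_MA M X \<longleftrightarrow> L2_summable (path_space M) (coord_fun \<alpha>)) \<and>
            (\<forall>D. L2_MA_with M X D \<longrightarrow> L2_sums (path_space M) (coord_fun \<alpha>) D))"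
proof -
  interpret prob_space M
    using assms by (simp add: semi_linear_process_def)
  interpret semi_linear M \<alpha> X
    by unfold_locales (rule assms)
  have "(L2_MA M X \<longleftrightarrow> L2_0_MA M X) \<and> (L2_0_MA M X \<longleftrightarrow> L2_summable \<P> (coord_fun \<alpha>)) \<and>
      (\<forall>D. L2_MA_with M X D \<longrightarrow> L2_sums \<P> (coord_fun \<alpha>) D)" if "summable (tail coeff_var)"
  proof -
    note sums = L2_sums_if_L2_MA_with[OF that]
    moreover have "L2_summable \<P> (coord_fun \<alpha>)" if "L2_MA M X"
      using that sums by (auto simp: L2_MA_def L2_summable_def)
    ultimately show ?thesis
      using L2_0_MA_if_L2_summable[OF that] L2_MA_if_L2_0_MA by blast
  qed
  then show ?thesis
    using summable_cond_exp_iff summable_cond_exp_iff_tail by blast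
qed

end
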